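(* Assume $\gcd(m,n)=1$, $d=m+n$. Let $x_0,x_1\in X$ with $x_1\in\partial(x_0)$, and let $\mu$ be an algebraic probability measure on $\mathbb{R}^d/x_0=\pi^{-1}(x_0)\subset Y$ of dimension $k$ with $1\le k<d$. Then there is a divergent sequence $(t_l)\subset\mathbb{R}_{\ge0}$ such that $(h_{t_l})_*\mu\to\nu$ in the weak* topology on finite measures on $Y$, where $\nu$ is an algebraic measure on $\mathbb{R}^d/x_1=\pi^{-1}(x_1)$ with $\dim\nu\ge k+1$.
   Context: $h_t=\operatorname{diag}(e^{nt}I_m,e^{-mt}I_n)$. $X$ is the space of unimodular lattices in $\mathbb{R}^d$ ($\cong\operatorname{SL}_d(\mathbb{R})/\operatorname{SL}_d(\mathbb{Z})$); $Y$ is the space of unimodular grids $x+v$ ($x\in X,v\in\mathbb{R}^d$), identified with $\operatorname{ASL}_d(\mathbb{R})/\operatorname{ASL}_d(\mathbb{Z})$ with quotient topology; $\operatorname{SL}_d(\mathbb{R})$ acts on $X$ and $Y$ linearly; $\pi:Y\to X$, $x+v\mapsto x$, with fibers $\pi^{-1}(x)=\mathbb{R}^d/x$. $\partial(x)$ is the set of $z\in X$ with $h_{s_k}x\to z$ for some unbounded $(s_k)\subset\mathbb{R}_{\ge0}$. A subspace $U\le\mathbb{R}^d$ is $x$-rational if $U\cap x$ contains a basis of $U$; an algebraic measure on $\mathbb{R}^d/x$ is the unique $U$-invariant probability measure on a coset $y+U$ ($U$ $x$-rational, $y\in\mathbb{R}^d/x$), of dimension $\dim U$. Weak* topology is the one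 dual to compactly-supported/vanishing-at-infinity continuous functions. *)

theory Defs
  imports "HOL-Probability.Probability"
begin

section \<open>Quotient topologies, Borel measures and weak* convergence\<close>

definition quotient_top :: "'a topology \<Rightarrow> ('a \<Rightarrow> 'b) \<Rightarrow> 'b topology" where
  "quotient_top T f =
     topology (\<lambda>V. V \<subseteq> f ` topspace T \<and> openin T {x \<in> topspace T. f x \<in> V})"

lemma openin_quotient_top:
  "openin (quotient_top T f) V \<longleftrightarrow>
     V \<subseteq> f ` topspace T \<and> openin T {x \<in> topspace T. f x \<in> V}"
proof -
  have "istopology (\<lambda>V. V \<subseteq> f ` topspace T \<and> openin T {x \<in> topspace T. f x \<in> V})"
    unfolding istopology_def
  proof (intro conjI allI impI)
    fix S V
    assume "S \<subseteq> f ` topspace T \<and> openin T {x \<in> topspace T. f x \<in> S}"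
      and "V \<subseteq> f ` topspace T \<and> openin T {x \<in> topspace T. f x \<in> V}"
    moreover have "{x \<in> topspace T. f x \<in> S \<inter> V}
        = {x \<in> topspace T. f x \<in> S} \<inter> {x \<in> topspace T. f x \<in> V}"
      by auto
    ultimately show "S \<inter> V \<subseteq> f ` topspace T" "openin T {x \<in> topspace T. f x \<in> S \<inter> V}"
      by auto
  next
    fix \<K>
    assume *: "\<forall>K\<in>\<K>. K \<subseteq> f ` topspace T \<and> openin T {x \<in> topspace T. f x \<in> K}"
    then show "\<Union>\<K> \<subseteq> f ` topspace T" by blast
    have "{x \<in> topspace T. f x \<in> \<Union>\<K>} = (\<Union>K\<in>\<K>. {x \<in> topspace T. f x \<in> K})"
      by auto
    with * show "openin T {x \<in> topspace T. f x \<in> \<Union>\<K>}"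
      by auto
  qed
  then show ?thesis
    by (simp add: quotient_top_def topology_inverse')
qed

lemma topspace_quotient_top [simp]: "topspace (quotient_top T f) = f ` topspace T"
proof -
  have "{x \<in> topspace T. f x \<in> f ` topspace T} = topspace T" by auto
  then have "openin (quotient_top T f) (f ` topspace T)"
    by (simp add: openin_quotient_top)
  then show ?thesis
    by (meson openin_quotient_top openin_subset openin_topspace subset_antisym)
qed

lemma quotient_map_quotient_top: "quotient_map T (quotient_top T f) f"
  by (auto simp: quotient_map_def openin_quotient_top)

definition borel_sigma :: "'a topology \<Rightarrow> 'a measure" where
  "borel_sigma T = sigma (topspace T) {U. openin T U}"

lemma space_borel_sigma [simp]: "space (borel_sigma T) = topspace T"
  unfolding borel_sigma_def by (rule space_measure_of) (auto dest: openin_subset)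

lemma sets_borel_sigma: "sets (borel_sigma T) = sigma_sets (topspace T) {U. openin T U}"
  by (auto simp: borel_sigma_def intro!: sets_measure_of dest: openin_subset)

lemma measurable_borel_sigma:
  assumes "continuous_map S T f"
  shows "f \<in> measurable (borel_sigma S) (borel_sigma T)"
  
proof (rule measurable_sigma_sets)
  show "sets (borel_sigma T) = sigma_sets (topspace T) {U. openin T U}"
    by (rule sets_borel_sigma)
  show "{U. openin T U} \<subseteq> Pow (topspace T)" by (auto dest: openin_subset)
  show "f \<in> space (borel_sigma S) \<rightarrow> topspace T"
    using assms by (auto simp: continuous_map_def)
  fix U assume "U \<in> {U. openin T U}"
  with assms have "openin S {x \<in> topspace S. f x \<in> U}"
    by (auto simp: continuous_map_def)
  moreover have "f -` U \<inter> space (borel_sigma S) = {x \<in> topspace S. f x \<in> U}" by auto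
  ultimately show "f -` U \<inter> space (borel_sigma S) \<in> sets (borel_sigma S)"
    by (simp add: sets_borel_sigma sigma_sets.Basic)
qed

definition vanishing_at_infinity :: "'a topology \<Rightarrow> ('a \<Rightarrow> real) set" where
  "vanishing_at_infinity T =
     {f. continuous_map T euclideanreal f \<and>
         (\<forall>\<epsilon>>0. \<exists>K. compactin T K \<and> (\<forall>y \<in> topspace T - K. \<bar>f y\<bar> < \<epsilon>))}"

definition finite_borel_measures :: "'a topology \<Rightarrow> 'a measure set" where
  "finite_borel_measures T = {\<mu>. finite_measure \<mu> \<and> sets \<mu> = sets (borel_sigma T)}"

text \<open>The coarsest topology for which \<open>\<mu> \<mapsto> \<integral> f d\<mu>\<close> is continuous for every \<open>f\<close> vanishing at
  infinity, obtained by pulling back the topology of pointwise convergence.\<close>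

definition weak_star_topology :: "'a topology \<Rightarrow> 'a measure topology" where
  "weak_star_topology T =
     pullback_topology (finite_borel_measures T)
       (\<lambda>\<mu>. \<lambda>f \<in> vanishing_at_infinity T. integral\<^sup>L \<mu> f)
       (powertop_real (vanishing_at_infinity T))"

lemma limitin_weak_star_topology:
  "limitin (weak_star_topology T) M \<nu> F \<longleftrightarrow>
     \<nu> \<in> finite_borel_measures T \<and> (\<forall>\<^sub>F l in F. M l \<in> finite_borel_measures T) \<and>
     (\<forall>f \<in> vanishing_at_infinity T. ((\<lambda>l. integral\<^sup>L (M l) f) \<longlongrightarrow> integral\<^sup>L \<nu> f) F)"
  (is "?L \<longleftrightarrow> ?R")
proof -
  define J where "J = (\<lambda>\<mu>. \<lambda>f \<in> vanishing_at_infinity T. integral\<^sup>L \<mu> f)"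
  define P where "P = powertop_real (vanishing_at_infinity T)"
  have W: "weak_star_topology T = pullback_topology (finite_borel_measures T) J P"
    by (simp add: weak_star_topology_def J_def P_def)
  have JP: "J \<mu> \<in> topspace P" for \<mu>
    by (simp add: J_def P_def)
  have lim: "limitin P (\<lambda>l. J (M l)) (J \<nu>) F \<longleftrightarrow>
      (\<forall>f \<in> vanishing_at_infinity T. ((\<lambda>l. integral\<^sup>L (M l) f) \<longlongrightarrow> integral\<^sup>L \<nu> f) F)"
    by (simp add: P_def J_def limitin_componentwise)
  have "?L \<longleftrightarrow> \<nu> \<in> finite_borel_measures T \<and> (\<forall>\<^sub>F l in F. M l \<in> finite_borel_measures T) \<and>
      limitin P (\<lambda>l. J (M l)) (J \<nu>) F"
  proof (intro iffI conjI)
    assume L: ?L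
    then show nu: "\<nu> \<in> finite_borel_measures T"
      by (auto simp: limitin_def W topspace_pullback_topology)
    have "openin (weak_star_topology T) (topspace (weak_star_topology T))" by simp
    with L have "\<forall>\<^sub>F l in F. M l \<in> topspace (weak_star_topology T)"
      by (metis limitin_def)
    then show "\<forall>\<^sub>F l in F. M l \<in> finite_borel_measures T"
      by (rule eventually_mono) (auto simp: W topspace_pullback_topology)
    show "limitin P (\<lambda>l. J (M l)) (J \<nu>) F"
      unfolding limitin_def
    proof (intro conjI JP allI impI)
      fix U assume U: "openin P U \<and> J \<nu> \<in> U"
      then have "openin (weak_star_topology T) (J -` U \<inter> finite_borel_measures T)"
        by (auto simp: W openin_pullback_topology)
      with L U nu have "\<forall>\<^sub>F l in F. M l \<in> J -` U \<inter> finite_borel_measures T"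
        unfolding limitin_def by blast
      then show "\<forall>\<^sub>F l in F. J (M l) \<in> U"
        by (rule eventually_mono) auto
    qed
  next
    assume R: "\<nu> \<in> finite_borel_measures T \<and>
      (\<forall>\<^sub>F l in F. M l \<in> finite_borel_measures T) \<and> limitin P (\<lambda>l. J (M l)) (J \<nu>) F"
    show ?L
      unfolding limitin_def
    proof (intro conjI allI impI)
      show "\<nu> \<in> topspace (weak_star_topology T)"
        using R JP by (simp add: W topspace_pullback_topology)
      fix V assume "openin (weak_star_topology T) V \<and> \<nu> \<in> V"
      then obtain U where U: "openin P U" "V = J -` U \<inter> finite_borel_measures T" "\<nu> \<in> V"
        by (auto simp: W openin_pullback_topology)
      with R have "\<forall>\<^sub>F l in F. J (M l) \<in> U"
        by (auto simp: limitin_def)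
      moreover from R have "\<forall>\<^sub>F l in F. M l \<in> finite_borel_measures T" by simp
      ultimately show "\<forall>\<^sub>F l in F. M l \<in> V"
        by eventually_elim (simp add: U)
    qed
  qed
  with lim show ?thesis by simp
qed

section \<open>The spaces of unimodular lattices and grids\<close>

definition integer_vectors :: "(real^'d) set" where
  "integer_vectors = {v. \<forall>i. v $ i \<in> \<int>}"

definition SL_top :: "(real^'d^'d) topology" where
  "SL_top = top_of_set {g. det g = 1}"

text \<open>The pair \<open>(g, v)\<close> stands for the affine map \<open>w \<mapsto> g w + v\<close>.\<close>

definition ASL_top :: "((real^'d^'d) \<times> (real^'d)) topology" where
  "ASL_top = top_of_set ({g. det g = 1} \<times> UNIV)"

definition lattice_of :: "real^'d^'d \<Rightarrow> (real^'d) set" where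
  "lattice_of g = (*v) g ` integer_vectors"

definition grid_of :: "(real^'d^'d) \<times> (real^'d) \<Rightarrow> (real^'d) set" where
  "grid_of = (\<lambda>(g, v). (+) v ` lattice_of g)"

text \<open>Lattices and grids are subsets of \<open>\<real>\<^sup>d\<close>. The fibres of \<^const>\<open>lattice_of\<close> on
  \<open>SL\<^sub>d(\<real>)\<close> are the cosets of \<open>SL\<^sub>d(\<int>)\<close>, and the fibres of \<^const>\<open>grid_of\<close> on \<open>ASL\<^sub>d(\<real>)\<close> are
  the cosets of \<open>ASL\<^sub>d(\<int>)\<close>, so the topologies below are those of the homogeneous spaces.\<close>

definition lattice_space :: "(real^'d) set topology" where
  "lattice_space = quotient_top SL_top lattice_of"

definition grid_space :: "(real^'d) set topology" where
  "grid_space = quotient_top ASL_top grid_of"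

lemma topspace_lattice_space: "topspace lattice_space = {lattice_of g |g. det g = 1}"
  by (auto simp: lattice_space_def SL_top_def)

lemma topspace_grid_space:
  "topspace grid_space = {(+) v ` x |x v. x \<in> topspace lattice_space}"
  by (auto simp: grid_space_def ASL_top_def topspace_lattice_space grid_of_def image_iff)

definition grid_lattice :: "(real^'d) set \<Rightarrow> (real^'d) set" where
  "grid_lattice y = {a - b |a b. a \<in> y \<and> b \<in> y}"

lemma grid_lattice_translate:
  assumes "x \<in> topspace lattice_space"
  shows "grid_lattice ((+) v ` x) = x"
proof -
  obtain g where x: "x = lattice_of g"
    using assms unfolding topspace_lattice_space by blast
  have diff: "a - b \<in> x" if ab: "a \<in> x" "b \<in> x" for a b
  proof -
    obtain p q where pq: "p \<in> integer_vectors" "q \<in> integer_vectors" "a = g *v p" "b = g *v q"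
      using ab by (auto simp: x lattice_of_def)
    then have "p - q \<in> integer_vectors" "a - b = g *v (p - q)"
      by (simp_all add: integer_vectors_def matrix_vector_mult_diff_distrib)
    then show ?thesis
      by (auto simp: x lattice_of_def)
  qed
  have "0 \<in> integer_vectors" by (simp add: integer_vectors_def)
  then have zero: "0 \<in> x"
    unfolding x lattice_of_def by (metis imageI matrix_vector_mult_0_right)
  show ?thesis
  proof (intro equalityI subsetI)
    fix a assume "a \<in> grid_lattice ((+) v ` x)"
    then show "a \<in> x"
      using diff by (auto simp: grid_lattice_def)
  next
    fix a assume "a \<in> x"
    then have "a = (v + a) - (v + 0) \<and> v + a \<in> (+) v ` x \<and> v + 0 \<in> (+) v ` x"
      using zero by auto
    then show "a \<in> grid_lattice ((+) v ` x)"
      unfolding grid_lattice_def by blast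
  qed
qed

definition lattice_torus :: "(real^'d) set \<Rightarrow> (real^'d) set set" where
  "lattice_torus x = {y \<in> topspace grid_space. grid_lattice y = x}"

lemma lattice_torus_eq:
  assumes "x \<in> topspace lattice_space"
  shows "lattice_torus x = range (\<lambda>v. (+) v ` x)"
  using assms by (auto simp: lattice_torus_def topspace_grid_space grid_lattice_translate)

lemma continuous_map_SL_grid_space:
  assumes "det g = 1"
  shows "continuous_map grid_space grid_space ((`) ((*v) g))"
proof -
  have eq: "(*v) g ` grid_of p = grid_of (g ** fst p, g *v snd p)" for p
    by (auto simp: grid_of_def lattice_of_def image_image matrix_vector_mul_assoc
        matrix_vector_right_distrib split: prod.splits)
  have "continuous_map ASL_top ASL_top (\<lambda>p. (g ** fst p, g *v snd p))"
  proof -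
    have "continuous_on A (\<lambda>p. (g ** fst p, g *v snd p))" for A
      unfolding matrix_matrix_mult_def matrix_vector_mult_def by (intro continuous_intros)
    then show ?thesis
      using assms by (auto simp: ASL_top_def continuous_map_in_subtopology det_mul)
  qed
  moreover have "continuous_map ASL_top grid_space grid_of"
    unfolding grid_space_def by (intro quotient_imp_continuous_map quotient_map_quotient_top)
  ultimately have "continuous_map ASL_top grid_space ((`) ((*v) g) \<circ> grid_of)"
    using continuous_map_compose[of ASL_top ASL_top _ grid_space grid_of]
    by (simp add: o_def eq)
  then show ?thesis
    unfolding grid_space_def
    by (rule continuous_compose_quotient_map[OF quotient_map_quotient_top])
qed

lemma continuous_map_translation_grid_space:
  "continuous_map grid_space grid_space ((`) ((+) u))"
proof -
  have eq: "(+) u ` grid_of p = grid_of (fst p, u + snd p)" for p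
    by (auto simp: grid_of_def image_image add.assoc split: prod.splits)
  have "continuous_map ASL_top ASL_top (\<lambda>p. (fst p, u + snd p))"
    unfolding ASL_top_def
    by (auto simp: continuous_map_in_subtopology intro!: continuous_intros)
  moreover have "continuous_map ASL_top grid_space grid_of"
    unfolding grid_space_def by (intro quotient_imp_continuous_map quotient_map_quotient_top)
  ultimately have "continuous_map ASL_top grid_space ((`) ((+) u) \<circ> grid_of)"
    using continuous_map_compose[of ASL_top ASL_top _ grid_space grid_of]
    by (simp add: o_def eq)
  then show ?thesis
    unfolding grid_space_def
    by (rule continuous_compose_quotient_map[OF quotient_map_quotient_top])
qed

section \<open>Algebraic measures\<close>

definition rational_subspace :: "(real^'d) set \<Rightarrow> (real^'d) set \<Rightarrow> bool" where
  "rational_subspace x U \<longleftrightarrow>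
     subspace U \<and> (\<exists>B. B \<subseteq> U \<inter> x \<and> independent B \<and> span B = U)"

text \<open>Measures on the torus \<open>\<real>\<^sup>d/x\<close> are regarded as measures on the space of grids.\<close>

definition algebraic_measure ::
  "(real^'d) set \<Rightarrow> nat \<Rightarrow> (real^'d) set measure \<Rightarrow> bool" where
  "algebraic_measure x k \<mu> \<longleftrightarrow>
     prob_space \<mu> \<and> sets \<mu> = sets (borel_sigma grid_space) \<and>
     (\<exists>U. rational_subspace x U \<and> dim U = k \<and>
       (\<exists>y \<in> lattice_torus x. emeasure \<mu> ((\<lambda>u. (+) u ` y) ` U) = 1) \<and>
       (\<forall>u \<in> U. distr \<mu> (borel_sigma grid_space) ((`) ((+) u)) = \<mu>))"

section \<open>The diagonal flow\<close>

text \<open>Here \<open>m = CARD('m)\<close>, \<open>n = CARD('n)\<close>, and \<open>\<real>\<^sup>d\<close> is indexed by \<open>'m + 'n\<close>.\<close>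

definition diag_flow :: "real \<Rightarrow> real^('m::finite + 'n::finite)^('m + 'n)" where
  "diag_flow t = (\<chi> i j. if i = j
     then case i of Inl _ \<Rightarrow> exp (real CARD('n) * t) | Inr _ \<Rightarrow> exp (- real CARD('m) * t)
     else 0)"

definition flow_limits ::
  "(real^('m::finite + 'n::finite)) set \<Rightarrow> (real^('m + 'n)) set set" where
  "flow_limits x = {z \<in> topspace lattice_space.
     \<exists>s :: nat \<Rightarrow> real. (\<forall>k. 0 \<le> s k) \<and> \<not> bounded (range s) \<and>
       limitin lattice_space (\<lambda>k. (*v) (diag_flow (s k)) ` x) z sequentially}"

lemma det_diag_flow: "det (diag_flow t :: real^('m::finite + 'n::finite)^('m + 'n)) = 1"
proof -
  have "det (diag_flow t :: real^('m + 'n)^('m + 'n))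
      = (\<Prod>i\<in>UNIV. diag_flow t $ i $ (i :: 'm + 'n))"
    by (rule det_diagonal) (simp add: diag_flow_def)
  also have "\<dots> = (\<Prod>i\<in>(UNIV :: 'm set). exp (real CARD('n) * t))
      * (\<Prod>j\<in>(UNIV :: 'n set). exp (- real CARD('m) * t))"
    by (simp add: diag_flow_def UNIV_Plus_UNIV[symmetric] prod.Plus del: UNIV_Plus_UNIV)
  also have "\<dots> = 1"
    by (simp flip: exp_of_nat_mult exp_add)
  finally show ?thesis .
qed

end

theory Submission
  imports Defs
begin

text \<open>Write the points of the flow orbit approaching \<open>x\<^sub>1\<close> as \<open>g\<^sub>l \<int>\<^sup>d\<close> with \<open>g\<^sub>l \<rightarrow> g\<close>, and transport
  the pushforwards of \<open>\<mu>\<close> to the standard torus by \<open>g\<^sub>l\<^sup>-\<^sup>1\<close>; they become algebraic measures along integral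
  subspaces \<open>U\<^sub>l\<close>. Choose an integral subspace \<open>W\<close> of maximal dimension that is orthogonal to \<open>U\<^sub>l\<close> for infinitely
  many \<open>l\<close>. Along that subsequence an integral frequency in \<open>W\<close> always annihilates \<open>U\<^sub>l\<close>, and one outside \<open>W\<close>
  does so only finitely often. As the Fourier coefficient of an algebraic measure at a frequency is a character
  value or \<open>0\<close>, depending on whether the frequency annihilates the subspace, the measures converge to an algebraic
  measure along \<open>W\<^sup>\<bottom>\<close>. If \<open>dim W\<^sup>\<bottom>\<close> were \<open>k\<close>, then \<open>U\<^sub>l\<close> would be constant, so the covolume of the
  lattice in the moving subspace would stay bounded above and below. But its Pluecker coordinates are scaled by
  exponentials of weights \<open>a n - b m\<close> with \<open>a \<le> m\<close>, \<open>b \<le> n\<close>, \<open>a + b = k\<close>, none of which is zero because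
  \<open>m\<close> and \<open>n\<close> are coprime.\<close>

section \<open>Integral matrices and integral bases\<close>

definition int_matrix :: "real^'n^'m \<Rightarrow> bool" where
  "int_matrix A \<longleftrightarrow> (\<forall>i j. A $ i $ j \<in> \<int>)"

lemma int_matrix_mult: "int_matrix A \<Longrightarrow> int_matrix B \<Longrightarrow> int_matrix (A ** B)"
  by (auto simp: int_matrix_def matrix_matrix_mult_def intro!: Ints_sum Ints_mult)

lemma det_in_Ints: "int_matrix A \<Longrightarrow> det A \<in> \<int>"
  unfolding det_def int_matrix_def by (intro Ints_sum Ints_mult Ints_prod) auto

lemma axis_in_integer_vectors [simp]: "axis i 1 \<in> integer_vectors"
  by (auto simp: integer_vectors_def axis_def)

lemma integer_vectors_add: "u \<in> integer_vectors \<Longrightarrow> v \<in> integer_vectors \<Longrightarrow> u + v \<in> integer_vectors"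
  and integer_vectors_diff: "u \<in> integer_vectors \<Longrightarrow> v \<in> integer_vectors \<Longrightarrow> u - v \<in> integer_vectors"
  and integer_vectors_uminus: "u \<in> integer_vectors \<Longrightarrow> - u \<in> integer_vectors"
  and zero_in_integer_vectors [simp]: "0 \<in> integer_vectors"
  by (auto simp: integer_vectors_def)

lemma inner_integer_vectors: "u \<in> integer_vectors \<Longrightarrow> v \<in> integer_vectors \<Longrightarrow> u \<bullet> v \<in> \<int>"
  by (auto simp: integer_vectors_def inner_vec_def intro!: Ints_sum Ints_mult)

lemma column_eq_mult_axis: "column j A = A *v axis j 1" for A :: "real^'n^'m"
  by (simp add: matrix_vector_mult_basis)

lemma int_matrixI:
  assumes "\<And>v. v \<in> integer_vectors \<Longrightarrow> A *v v \<in> integer_vectors"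
  shows "int_matrix A"
  unfolding int_matrix_def
proof (intro allI)
  fix i j
  have "A *v axis j 1 \<in> integer_vectors" by (rule assms) simp
  then show "A $ i $ j \<in> \<int>"
    by (simp add: integer_vectors_def matrix_vector_mult_basis column_def)
qed

lemma int_matrix_columnsI: "(\<And>j. column j A \<in> integer_vectors) \<Longrightarrow> int_matrix A"
  by (auto simp: int_matrix_def integer_vectors_def column_def)

section \<open>Inverses of integral matrices\<close>

lemma matrix_inv_mult:
  fixes A :: "real^'n^'n"
  assumes "det A \<noteq> 0"
  shows "A ** matrix_inv A = mat 1" "matrix_inv A ** A = mat 1"
proof -
  have "\<exists>B. A ** B = mat 1 \<and> B ** A = mat 1"
    using assms by (auto simp: invertible_det_nz[symmetric] invertible_def)
  from someI_ex[OF this] show "A ** matrix_inv A = mat 1" "matrix_inv A ** A = mat 1"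
    by (simp_all add: matrix_inv_def)
qed

lemma matrix_inv_mult_vec:
  fixes A :: "real^'n^'n"
  assumes "det A \<noteq> 0"
  shows "A *v (matrix_inv A *v v) = v" "matrix_inv A *v (A *v v) = v"
  using matrix_inv_mult[OF assms] by (simp_all add: matrix_vector_mul_assoc)

lemma matrix_inv_mult_mat:
  fixes A :: "real^'n^'n"
  assumes "det A \<noteq> 0"
  shows "A ** (matrix_inv A ** B) = B" "matrix_inv A ** (A ** B) = B"
  using matrix_inv_mult[OF assms] by (simp_all add: matrix_mul_assoc)

lemma det_matrix_inv:
  fixes A :: "real^'n^'n"
  assumes "det A \<noteq> 0"
  shows "det (matrix_inv A) = 1 / det A"
proof -
  have "det A * det (matrix_inv A) = 1"
    using arg_cong[OF matrix_inv_mult(1)[OF assms], of det] by (simp add: det_mul)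
  then show ?thesis using assms by (simp add: field_simps)
qed

text \<open>By Cramer's rule, \<open>det A\<close> times a coordinate of the solution of
  \<open>A *v x = v\<close> is the determinant of an integral matrix whenever \<open>v\<close> is
  integral. The scaled inverse is the adjugate.\<close>

lemma int_matrix_scaled_inverse:
  fixes A :: "real^'n^'n"
  assumes "int_matrix A" "det A \<noteq> 0"
  shows "int_matrix (det A *\<^sub>R matrix_inv A)"
proof (rule int_matrixI)
  fix v :: "real^'n" assume v: "v \<in> integer_vectors"
  define x where "x = matrix_inv A *v v"
  have "A *v x = v" using assms by (simp add: x_def matrix_inv_mult_vec)
  then have x: "x = (\<chi> k. det (\<chi> i j. if j = k then v$i else A$i$j) / det A)"
    using cramer[OF assms(2)] by blast
  have "det A * x $ k \<in> \<int>" for k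
  proof -
    have "det A * x $ k = det (\<chi> i j. if j = k then v$i else A$i$j)"
      using assms(2) by (subst x) simp
    also have "\<dots> \<in> \<int>"
      using assms(1) v by (intro det_in_Ints) (auto simp: int_matrix_def integer_vectors_def)
    finally show ?thesis .
  qed
  then show "(det A *\<^sub>R matrix_inv A) *v v \<in> integer_vectors"
    by (simp add: integer_vectors_def scaleR_matrix_vector_assoc[symmetric] x_def)
qed

text \<open>A device for treating Pluecker coordinates as determinants of square matrices: when
  \<open>\<sigma>\<close> is injective on \<open>- J\<close>, expanding along the coordinate columns
  leaves, up to sign, the minor of the vectors \<open>b j\<close> with \<open>j \<in> J\<close> on
  the rows outside the image of \<open>- J\<close> under \<open>\<sigma>\<close>.\<close>

definition mixed_columns :: "'d set \<Rightarrow> ('d \<Rightarrow> real^'d) \<Rightarrow> ('d \<Rightarrow> 'd) \<Rightarrow> real^'d^'d" where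
  "mixed_columns J b \<sigma> = (\<chi> i j. if j \<in> J then b j $ i else axis (\<sigma> j) 1 $ i)"

lemma column_mixed_columns:
  "column j (mixed_columns J b \<sigma>) = (if j \<in> J then b j else axis (\<sigma> j) 1)"
  by (auto simp: column_def mixed_columns_def vec_eq_iff)

text \<open>An independent family extends to a basis by coordinate vectors alone, and the added
  vectors can be indexed by \<open>- J\<close>. In other words, some Pluecker coordinate of an
  independent family is nonzero.\<close>

lemma exists_mixed_columns_det_nonzero:
  fixes b :: "'d::finite \<Rightarrow> real^'d"
  assumes "inj_on b J" "independent (b ` J)"
  shows "\<exists>\<sigma>. det (mixed_columns J b \<sigma>) \<noteq> 0"
proof -
  define Ax where "Ax = range (\<lambda>i::'d. axis i (1::real))"
  obtain B where B: "b ` J \<subseteq> B" "B \<subseteq> b ` J \<union> Ax" "independent B" "b ` J \<union> Ax \<subseteq> span B"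
    using maximal_independent_subset_extend[of "b ` J" "b ` J \<union> Ax"] assms(2) by blast
  have "Ax = Basis" by (auto simp: Ax_def Basis_vec_def)
  then have "span B = UNIV"
    using B(4) by (metis span_Basis span_mono span_span sup.bounded_iff top.extremum_uniqueI)
  then have card: "card B = CARD('d)"
    using dim_eq_card_independent[OF B(3)] dim_span[of B] by simp
  have finB: "finite B" using B(3) independent_imp_finite by blast
  have "card (B - b ` J) = card (- J)"
    using B(1) finB assms(1) card by (simp add: card_Diff_subset finite_subset card_image Compl_eq_Diff_UNIV)
  then obtain \<beta> where \<beta>: "bij_betw \<beta> (- J) (B - b ` J)"
    using finB finite_same_card_bij[of "- J" "B - b ` J"] by auto
  have "\<exists>i. \<beta> j = axis i 1" if "j \<notin> J" for j
    using \<beta> that B(2) unfolding bij_betw_def Ax_def by blast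
  then obtain \<sigma> where \<sigma>: "\<And>j. j \<notin> J \<Longrightarrow> \<beta> j = axis (\<sigma> j) 1" by metis
  have "columns (mixed_columns J b \<sigma>) = b ` J \<union> \<beta> ` (- J)"
    using \<sigma> by (auto simp: columns_def column_mixed_columns)
  also have "\<dots> = B" using \<beta> B(1) by (auto simp: bij_betw_def)
  finally have "\<exists>C. mixed_columns J b \<sigma> ** C = mat 1"
    using \<open>span B = UNIV\<close> by (simp add: matrix_right_invertible_span_columns span_vec_eq)
  then show ?thesis
    using invertible_right_inverse invertible_det_nz by blast
qed

text \<open>Completing by coordinate vectors keeps the matrix integral, at the price of a
  determinant that need not be a unit.\<close>

lemma integer_basis_matrix:
  fixes B :: "(real^'d) set" and J :: "'d set"
  assumes "B \<subseteq> integer_vectors" "independent B" "card J = card B"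
  obtains E :: "real^'d^'d" where "int_matrix E" "det E \<noteq> 0" "(\<lambda>j. column j E) ` J = B"
proof -
  have "finite B" using assms(2) independent_imp_finite by blast
  then obtain b where b: "bij_betw b J B"
    using assms(3) finite_same_card_bij[of J B] by auto
  then obtain \<sigma> where \<sigma>: "det (mixed_columns J b \<sigma>) \<noteq> 0"
    using exists_mixed_columns_det_nonzero[of b J] assms(2) by (auto simp: bij_betw_def)
  show thesis
  proof
    show "int_matrix (mixed_columns J b \<sigma>)"
      using b assms(1) by (intro int_matrix_columnsI) (auto simp: column_mixed_columns bij_betw_def)
    show "(\<lambda>j. column j (mixed_columns J b \<sigma>)) ` J = B"
      using b by (simp add: column_mixed_columns bij_betw_def)
  qed (rule \<sigma>)
qed

text \<open>Complete \<open>B\<close> to an integral matrix \<open>E\<close>. The dual basis scaled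
  by \<open>det E\<close> is again integral, and its members with index outside \<open>J\<close> are
  orthogonal to \<open>B\<close> and span the complement.\<close>

lemma integer_basis_orthogonal_comp:
  fixes B :: "(real^'d) set"
  assumes "B \<subseteq> integer_vectors" "independent B"
  obtains C where "C \<subseteq> integer_vectors" "independent C" "span C = (span B)\<^sup>\<bottom>"
    "card C + card B = CARD('d)"
proof -
  have cardB: "card B \<le> CARD('d)"
    using dim_eq_card_independent[OF assms(2)] dim_subset_UNIV[of B] by simp
  obtain J :: "'d set" where J: "card J = card B"
    using obtain_subset_with_card_n[of "card B" UNIV] cardB by auto
  obtain E where E: "int_matrix E" "det E \<noteq> 0" "(\<lambda>j. column j E) ` J = B"
    using integer_basis_matrix[OF assms J] by blast
  define F where "F = transpose (det E *\<^sub>R matrix_inv E)"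
  have F: "int_matrix F"
    using int_matrix_scaled_inverse[OF E(1,2)] by (simp add: F_def int_matrix_def transpose_def)
  have EF: "column i E \<bullet> column j F = (if i = j then det E else 0)" for i j
  proof -
    have "column i E \<bullet> column j F = det E * (matrix_inv E ** E) $ j $ i"
      by (simp add: inner_vec_def column_def F_def transpose_def matrix_matrix_mult_def
          sum_distrib_left mult_ac)
    then show ?thesis using E(2) by (simp add: matrix_inv_mult mat_def)
  qed
  define C where "C = (\<lambda>j. column j F) ` (- J)"
  have C_subset: "C \<subseteq> (span B)\<^sup>\<bottom>"
  proof
    fix v assume "v \<in> C"
    then obtain j where j: "j \<notin> J" "v = column j F" by (auto simp: C_def)
    have "w \<bullet> v = 0" if "w \<in> span B" for w
      using that
    proof (induction rule: span_induct)
      case base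
      show "subspace {w. w \<bullet> v = 0}" by (simp add: subspace_hyperplane2)
    next
      case (step w)
      then show ?case using E(3) j EF by auto
    qed
    then show "v \<in> (span B)\<^sup>\<bottom>" by (simp add: orthogonal_comp_def orthogonal_def)
  qed
  have span_C: "span C = (span B)\<^sup>\<bottom>"
  proof
    show "span C \<subseteq> (span B)\<^sup>\<bottom>"
      using C_subset subspace_orthogonal_comp by (rule span_minimal)
    show "(span B)\<^sup>\<bottom> \<subseteq> span C"
    proof
      fix v assume v: "v \<in> (span B)\<^sup>\<bottom>"
      \<comment> \<open>The pairings of \<open>v\<close> with the columns of \<open>E\<close> are
        the coefficients of \<open>det E\<close> times \<open>v\<close> in the columns of
        \<open>F\<close>; those with index in \<open>J\<close> vanish by orthogonality.\<close>
      define y where "y = transpose E *v v"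
      have y: "y $ j = column j E \<bullet> v" for j
        by (simp add: y_def matrix_vector_mult_def transpose_def column_def inner_vec_def)
      have y0: "y $ j = 0" if "j \<in> J" for j
      proof -
        have "column j E \<in> span B" using E(3) that by (blast intro: span_base)
        then show ?thesis using v by (simp add: y orthogonal_comp_def orthogonal_def)
      qed
      have "transpose (matrix_inv E) ** transpose E = mat 1"
        using E(2) by (simp add: matrix_transpose_mul[symmetric] matrix_inv_mult transpose_mat)
      then have "det E *\<^sub>R v = F *v y"
        by (simp add: F_def y_def transpose_scalar scaleR_matrix_vector_assoc[symmetric]
            matrix_vector_mul_assoc[of "transpose (matrix_inv E)"] del: vector_transpose_matrix transpose_matrix_vector)
      also have "\<dots> = (\<Sum>j\<in>UNIV. y $ j *\<^sub>R column j F)"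
        by (simp add: matrix_mult_sum scalar_mult_eq_scaleR)
      also have "\<dots> \<in> span C"
      proof (rule span_sum)
        fix j show "y $ j *\<^sub>R column j F \<in> span C"
          by (cases "j \<in> J") (auto simp: y0 C_def intro: span_zero span_scale span_base)
      qed
      finally have "(1 / det E) *\<^sub>R (det E *\<^sub>R v) \<in> span C" by (rule span_scale)
      then show "v \<in> span C" using E(2) by simp
    qed
  qed
  have "dim {v \<in> UNIV. \<forall>w \<in> span B. orthogonal w v} + dim (span B) = dim (UNIV :: (real^'d) set)"
    by (rule dim_subspace_orthogonal_to_vectors) auto
  then have dim: "dim ((span B)\<^sup>\<bottom>) + card B = CARD('d)"
    using assms(2) by (simp add: orthogonal_comp_def dim_eq_card_independent)
  have card_C: "card C \<le> CARD('d) - card B"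
    using card_image_le[of "- J" "\<lambda>j. column j F"] J
    by (simp add: C_def Compl_eq_Diff_UNIV card_Diff_subset)
  \<comment> \<open>An upper bound on \<open>card C\<close> suffices: a spanning set with at most as
    many elements as the dimension is independent. Distinctness of the columns then follows from the
    count.\<close>
  have "independent C"
    by (rule card_le_dim_spanning[of C "(span B)\<^sup>\<bottom>"])
       (use C_subset span_C dim card_C in \<open>auto simp: C_def\<close>)
  moreover have "C \<subseteq> integer_vectors"
    using F by (auto simp: C_def column_def int_matrix_def integer_vectors_def)
  moreover have "card C + card B = CARD('d)"
    using dim span_C dim_eq_card_independent[OF \<open>independent C\<close>] dim_span by metis
  ultimately show thesis using span_C that by blast
qed

section \<open>Weights of the diagonal flow\<close>

lemma diag_flow_mult_vec:
  "diag_flow t *v v = (\<chi> i. (case i of Inl _ \<Rightarrow> exp (real CARD('n) * t) | Inr _ \<Rightarrow> exp (- real CARD('m) * t)) * v $ i)"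
  for v :: "real^('m::finite + 'n::finite)"
proof -
  have "(\<Sum>j\<in>UNIV. (diag_flow t :: real^('m + 'n)^('m + 'n)) $ i $ j * v $ j)
      = (\<Sum>j\<in>UNIV. if i = j then (case i of Inl _ \<Rightarrow> exp (real CARD('n) * t) | Inr _ \<Rightarrow> exp (- real CARD('m) * t)) * v $ j else 0)" for i
    by (intro sum.cong) (auto simp: diag_flow_def)
  then show ?thesis
    by (simp add: matrix_vector_mult_def)
qed

definition flow_weight :: "'m::finite + 'n::finite \<Rightarrow> real" where
  "flow_weight i = (case i of Inl _ \<Rightarrow> real CARD('n) | Inr _ \<Rightarrow> - real CARD('m))"

lemma diag_flow_mult_axis:
  "diag_flow t *v axis i 1 = exp (flow_weight i * t) *\<^sub>R axis i 1"
  by (auto simp: diag_flow_mult_vec vec_eq_iff axis_def flow_weight_def split: sum.splits)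

text \<open>If \<open>S\<close> has \<open>a\<close> indices of the first kind and \<open>b\<close>
  of the second, the sum is \<open>a n - b m\<close>. Were it zero, coprimality would give that
  \<open>m\<close> divides \<open>a \<le> m\<close>, so \<open>a\<close> is \<open>0\<close> or
  \<open>m\<close> and \<open>S\<close> is empty or everything.\<close>

lemma sum_flow_weight_nonzero:
  fixes S :: "('m::finite + 'n::finite) set"
  assumes "coprime CARD('m) CARD('n)" "S \<noteq> {}" "S \<noteq> UNIV"
  shows "(\<Sum>i\<in>S. flow_weight i) \<noteq> 0"
proof
  assume sum0: "(\<Sum>i\<in>S. flow_weight i) = 0"
  define P where "P = {a::'m. Inl a \<in> S}"
  define Q where "Q = {b::'n. Inr b \<in> S}"
  have S: "S = P <+> Q"
  proof (intro set_eqI iffI)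
    fix x assume "x \<in> S" then show "x \<in> P <+> Q" by (cases x) (auto simp: P_def Q_def)
  qed (auto simp: P_def Q_def)
  have "(\<Sum>i\<in>S. flow_weight i) = real (card P) * real CARD('n) - real (card Q) * real CARD('m)"
    by (simp add: S sum.Plus flow_weight_def)
  with sum0 have "real (card P * CARD('n)) = real (card Q * CARD('m))" by simp
  then have eq: "card P * CARD('n) = card Q * CARD('m)" using of_nat_eq_iff by blast
  then have "CARD('m) dvd card P"
    using assms(1) by (metis coprime_dvd_mult_left_iff dvd_triv_right)
  moreover have "card P \<le> CARD('m)" by (simp add: card_mono)
  ultimately consider "card P = 0" | "card P = CARD('m)"
    using dvd_imp_le by fastforce
  then show False
  proof cases
    case 1
    with eq have "card Q = 0" by auto
    with 1 have "S = {}" by (simp add: S)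
    with assms show False by simp
  next
    case 2
    with eq have "card Q = CARD('n)" by auto
    with 2 have "P = UNIV" "Q = UNIV" by (simp_all add: card_eq_UNIV_imp_eq_UNIV)
    then have "S = UNIV" by (simp add: S)
    with assms show False by simp
  qed
qed

text \<open>Applying the flow to the whole completed matrix also stretches the coordinate columns;
  the diagonal matrix \<open>D\<close> on the right undoes this. As the flow has determinant 1, only
  the inverse stretching factors of the coordinate columns remain.\<close>

lemma det_mixed_columns_diag_flow:
  fixes X :: "real^('m::finite + 'n::finite)^('m + 'n)"
  shows "det (mixed_columns J (\<lambda>j. column j (diag_flow t ** X)) \<sigma>)
    = exp (- (\<Sum>j\<in>-J. flow_weight (\<sigma> j)) * t) * det (mixed_columns J (\<lambda>j. column j X) \<sigma>)"
proof -
  define D :: "real^('m + 'n)^('m + 'n)" where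
    "D = (\<chi> i j. if i = j then (if j \<in> J then 1 else exp (- flow_weight (\<sigma> j) * t)) else 0)"
  have D_axis: "D *v axis j 1 = (if j \<in> J then 1 else exp (- flow_weight (\<sigma> j) * t)) *\<^sub>R axis j 1" for j
    unfolding column_eq_mult_axis[symmetric] by (auto simp: column_def D_def vec_eq_iff axis_def)
  have "mixed_columns J (\<lambda>j. column j (diag_flow t ** X)) \<sigma>
      = (diag_flow t ** mixed_columns J (\<lambda>j. column j X) \<sigma>) ** D" (is "?L = ?R")
  proof -
    have "column j ?L = column j ?R" for j
    proof -
      have col: "column j (A ** B) = A *v column j B" for A B :: "real^('m + 'n)^('m + 'n)"
        by (simp only: column_eq_mult_axis matrix_vector_mul_assoc)
      have "column j ?R = (if j \<in> J then 1 else exp (- flow_weight (\<sigma> j) * t)) *\<^sub>R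
          (diag_flow t *v column j (mixed_columns J (\<lambda>j. column j X) \<sigma>))"
        unfolding column_eq_mult_axis[of _ ?R] column_eq_mult_axis[of _ "mixed_columns _ _ _"]
          matrix_vector_mul_assoc[symmetric] D_axis matrix_scaleR_vector_ac
        by (simp add: matrix_vector_mul_assoc scaleR_matrix_vector_assoc[symmetric])
      then show ?thesis
        by (simp add: column_mixed_columns col diag_flow_mult_axis flip: exp_add)
    qed
    then show ?thesis by (simp add: vec_eq_iff column_def)
  qed
  moreover have "det D = (\<Prod>j\<in>UNIV. if j \<in> J then 1 else exp (- flow_weight (\<sigma> j) * t))"
    by (subst det_diagonal) (auto simp: D_def)
  moreover have "\<dots> = exp (- (\<Sum>j\<in>-J. flow_weight (\<sigma> j)) * t)"
    by (simp add: prod.If_cases exp_sum sum_negf[symmetric] sum_distrib_right flip: Compl_eq)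
  ultimately show ?thesis
    by (simp add: det_mul det_diag_flow)
qed

text \<open>The hypotheses say that \<open>M\<close> mixes the columns in \<open>J\<close> among
  themselves and fixes the others. Hence all Pluecker coordinates of a subspace basis change by the
  common factor \<open>det M\<close> under a change of that basis.\<close>

lemma mixed_columns_mult:
  fixes G M :: "real^'d^'d"
  assumes "\<And>i j. j \<in> J \<Longrightarrow> i \<notin> J \<Longrightarrow> M $ i $ j = 0"
    and "\<And>i j. j \<notin> J \<Longrightarrow> M $ i $ j = (if i = j then 1 else 0)"
  shows "mixed_columns J (\<lambda>j. column j (G ** M)) \<sigma> = mixed_columns J (\<lambda>j. column j G) \<sigma> ** M"
proof -
  have "mixed_columns J (\<lambda>j. column j (G ** M)) \<sigma> $ i $ j
      = (mixed_columns J (\<lambda>j. column j G) \<sigma> ** M) $ i $ j" for i j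
  proof (cases "j \<in> J")
    case True
    then show ?thesis
      by (auto simp: mixed_columns_def column_def matrix_matrix_mult_def assms(1) intro!: sum.cong)
  next
    case False
    have "(\<Sum>k\<in>UNIV. (mixed_columns J (\<lambda>j. column j G) \<sigma>) $ i $ k * M $ k $ j)
      = (\<Sum>k\<in>UNIV. if k = j then (mixed_columns J (\<lambda>j. column j G) \<sigma>) $ i $ j else 0)"
      by (intro sum.cong) (auto simp: assms(2) False)
    then show ?thesis using False
      by (simp add: matrix_matrix_mult_def) (simp add: mixed_columns_def)
  qed
  then show ?thesis by (simp add: vec_eq_iff)
qed

text \<open>A nonzero integer has absolute value at least 1, and scaling by \<open>N\<close>
  multiplies the determinant by \<open>N ^ CARD('d)\<close>.\<close>

lemma int_multiple_det_bound:
  fixes M :: "real^'d^'d"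
  assumes "int_matrix (N *\<^sub>R M)" "det M \<noteq> 0" "N \<noteq> 0"
  shows "1 \<le> \<bar>N\<bar> ^ CARD('d) * \<bar>det M\<bar>"
proof -
  have "N *\<^sub>R M = matrix ((*\<^sub>R) N) ** M"
    by (simp add: matrix_scaleR vec_eq_iff matrix_matrix_mult_def mat_def if_distrib[of "\<lambda>x. x * _"] cong: if_cong)
  then have det: "det (N *\<^sub>R M) = N ^ CARD('d) * det M"
    by (simp add: det_mul)
  with assms have "det (N *\<^sub>R M) \<noteq> 0" by simp
  with det_in_Ints[OF assms(1)] have "1 \<le> \<bar>det (N *\<^sub>R M)\<bar>" by (rule Ints_nonzero_abs_ge1)
  then show ?thesis by (simp add: det abs_mult power_abs)
qed

text \<open>The diagonal blocks are compared by writing a block triangular matrix as the product of two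
  matrices of the same kind, each having an identity block.\<close>

lemma block_triangular_det_bounds:
  fixes M :: "real^'d^'d"
  assumes blk: "\<And>i j. j \<in> J \<Longrightarrow> i \<notin> J \<Longrightarrow> M $ i $ j = 0"
    and N: "int_matrix (N *\<^sub>R M)" "N \<in> \<int>" "N \<noteq> 0" and M: "det M \<noteq> 0"
  defines "R \<equiv> (\<chi> i j. if j \<in> J then M $ i $ j else if i = j then 1 else 0)"
  shows "1 / \<bar>N\<bar> ^ CARD('d) \<le> \<bar>det R\<bar>" "\<bar>det R\<bar> \<le> \<bar>N\<bar> ^ CARD('d) * \<bar>det M\<bar>"
proof -
  define S :: "real^'d^'d" where "S = (\<chi> i j. if j \<in> J then (if i = j then 1 else 0) else M $ i $ j)"
  have "(S ** R) $ i $ j = M $ i $ j" for i j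
  proof (cases "j \<in> J")
    case True
    then have "(\<Sum>k\<in>UNIV. S $ i $ k * R $ k $ j) = (\<Sum>k\<in>UNIV. if k = i then M $ i $ j else 0)"
      by (intro sum.cong) (auto simp: S_def R_def blk)
    then show ?thesis by (simp add: matrix_matrix_mult_def)
  next
    case False
    then have "(\<Sum>k\<in>UNIV. S $ i $ k * R $ k $ j) = (\<Sum>k\<in>UNIV. if k = j then M $ i $ j else 0)"
      by (intro sum.cong) (auto simp: S_def R_def)
    then show ?thesis by (simp add: matrix_matrix_mult_def)
  qed
  then have "S ** R = M" by (simp add: vec_eq_iff)
  then have det: "det S * det R = det M" by (metis det_mul)
  with M have nz: "det S \<noteq> 0" "det R \<noteq> 0" by auto
  have "int_matrix (N *\<^sub>R S)" "int_matrix (N *\<^sub>R R)"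
    using N by (auto simp: int_matrix_def S_def R_def)
  with nz N have S1: "1 \<le> \<bar>N\<bar> ^ CARD('d) * \<bar>det S\<bar>" and R1: "1 \<le> \<bar>N\<bar> ^ CARD('d) * \<bar>det R\<bar>"
    by (auto intro: int_multiple_det_bound)
  have pos: "\<bar>N\<bar> ^ CARD('d) > 0" using N by simp
  show "1 / \<bar>N\<bar> ^ CARD('d) \<le> \<bar>det R\<bar>"
    using R1 pos by (simp add: divide_le_eq mult.commute)
  \<comment> \<open>The upper bound on \<open>det R\<close> comes from the lower bound on
    \<open>det S\<close>, as the two multiply to \<open>det M\<close>.\<close>
  have "\<bar>det R\<bar> \<le> (\<bar>N\<bar> ^ CARD('d) * \<bar>det S\<bar>) * \<bar>det R\<bar>"
    using S1 by (metis abs_ge_zero mult_le_cancel_right1 mult.commute mult_1 mult_right_mono)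
  then show "\<bar>det R\<bar> \<le> \<bar>N\<bar> ^ CARD('d) * \<bar>det M\<bar>"
    by (simp add: det[symmetric] abs_mult mult.assoc)
qed

section \<open>Pluecker coordinates of a rational subspace along the flow\<close>

lemma matrix_inv_mult_span_columns:
  fixes E :: "real^'d^'d"
  assumes "det E \<noteq> 0" "v \<in> span ((\<lambda>j. column j E) ` J)" "i \<notin> J"
  shows "(matrix_inv E *v v) $ i = 0"
  using assms(2)
proof (induction rule: span_induct)
  case base
  show "subspace {v. (matrix_inv E *v v) $ i = 0}"
    by (auto simp: subspace_def matrix_vector_right_distrib matrix_scaleR_vector_ac
        scaleR_matrix_vector_assoc[symmetric])
next
  case (step v)
  then obtain j where "j \<in> J" "v = E *v axis j 1" by (auto simp: column_eq_mult_axis)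
  with assms show ?case by (auto simp: matrix_inv_mult_vec axis_def)
qed

lemma tendsto_mixed_columns:
  assumes "(g \<longlongrightarrow> h) F"
  shows "((\<lambda>l. det (mixed_columns J (\<lambda>j. column j (g l ** X)) \<sigma>))
    \<longlongrightarrow> det (mixed_columns J (\<lambda>j. column j (h ** X)) \<sigma>)) F"
proof -
  have "((\<lambda>l. mixed_columns J (\<lambda>j. column j (g l ** X)) \<sigma> $ i $ k)
      \<longlongrightarrow> mixed_columns J (\<lambda>j. column j (h ** X)) \<sigma> $ i $ k) F" for i k
    by (cases "k \<in> J")
      (auto simp: mixed_columns_def column_def matrix_matrix_mult_def
        intro!: tendsto_intros assms)
  then show ?thesis
    unfolding det_def by (intro tendsto_sum tendsto_mult tendsto_const tendsto_prod)
qed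

text \<open>The flow scales the minors of a basis of \<open>span B\<close> by exponentials, whereas integrality keeps the
  determinants of the changes of basis from \<open>span B\<close> to \<open>span C\<close> between positive bounds.\<close>

lemma flow_not_returning_to_rational_subspace:
  fixes g\<^sub>0 g :: "real^('m::finite + 'n::finite)^('m + 'n)"
    and \<gamma> G :: "nat \<Rightarrow> real^('m + 'n)^('m + 'n)"
  assumes cop: "coprime CARD('m) CARD('n)"
    and B: "B \<subseteq> integer_vectors" "independent B" "0 < card B" "card B < CARD('m) + CARD('n)"
    and C: "C \<subseteq> integer_vectors" "independent C" "card C = card B"
    and g: "G \<longlonglongrightarrow> g" "det g = 1"
    and \<gamma>: "\<And>l. int_matrix (\<gamma> l)" "\<And>l. det (\<gamma> l) = 1"
    and eq: "\<And>l. diag_flow (t l) ** g\<^sub>0 = G l ** \<gamma> l"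
    and t: "filterlim t at_top sequentially"
    and BC: "\<And>l. (*v) (\<gamma> l) ` span B \<subseteq> span C"
  shows False
proof -
  obtain J :: "('m + 'n) set" where J: "card J = card B"
    using obtain_subset_with_card_n[of "card B" "UNIV :: ('m + 'n) set"] B(4) by auto
  obtain E where E: "int_matrix E" "det E \<noteq> 0" "(\<lambda>j. column j E) ` J = B"
    using integer_basis_matrix[OF B(1,2) J] by blast
  have J': "card J = card C" using J C(3) by simp
  obtain E' where E': "int_matrix E'" "det E' \<noteq> 0" "(\<lambda>j. column j E') ` J = C"
    using integer_basis_matrix[OF C(1,2) J'] by blast
  \<comment> \<open>\<open>M l\<close> is the matrix of \<open>\<gamma> l\<close> from the basis of
    columns of \<open>E\<close> to that of \<open>E'\<close>. Its columns in \<open>J\<close>, kept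
    in \<open>R l\<close>, describe the map from \<open>span B\<close> to \<open>span C\<close>, so
    \<open>det (R l)\<close> is the determinant of that map.\<close>
  define M where "M l = matrix_inv E' ** (\<gamma> l ** E)" for l
  define R where "R l = (\<chi> i j. if j \<in> J then M l $ i $ j else if i = j then 1 else 0)" for l
  have blk: "M l $ i $ j = 0" if "j \<in> J" "i \<notin> J" for l i j
  proof -
    have "column j E \<in> span B" using E(3) that by (blast intro: span_base)
    then have "\<gamma> l *v column j E \<in> span C" using BC by blast
    then have "(matrix_inv E' *v (\<gamma> l *v column j E)) $ i = 0"
      using matrix_inv_mult_span_columns[OF E'(2) _ that(2)] E'(3) by simp
    moreover have "matrix_inv E' *v (\<gamma> l *v column j E) = column j (M l)"
      by (simp only: column_eq_mult_axis M_def matrix_vector_mul_assoc)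
    ultimately show ?thesis by (simp add: column_def)
  qed
  \<comment> \<open>The factor \<open>det E'\<close> clears the denominators of the inverse of
    \<open>E'\<close> for all \<open>l\<close> at once, which makes the bounds \<open>c1\<close> and
    \<open>c2\<close> below uniform.\<close>
  have int: "int_matrix (det E' *\<^sub>R M l)" for l
  proof -
    have "det E' *\<^sub>R M l = (det E' *\<^sub>R matrix_inv E') ** (\<gamma> l ** E)"
      by (simp add: M_def vec_eq_iff matrix_matrix_mult_def sum_distrib_left mult.assoc)
    then show ?thesis
      by (simp add: int_matrix_mult int_matrix_scaled_inverse E E' \<gamma>)
  qed
  have detM: "det (M l) = det E / det E'" for l
    using E'(2) \<gamma>(2) by (simp add: M_def det_mul det_matrix_inv)
  define c1 where "c1 = 1 / \<bar>det E'\<bar> ^ CARD('m + 'n)"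
  define c2 where "c2 = \<bar>det E'\<bar> ^ CARD('m + 'n) * \<bar>det E / det E'\<bar>"
  have R: "c1 \<le> \<bar>det (R l)\<bar>" "\<bar>det (R l)\<bar> \<le> c2" for l
    using block_triangular_det_bounds[of J "M l" "det E'", OF blk int] E E' det_in_Ints[OF E'(1)]
    by (simp_all add: R_def c1_def c2_def detM)
  have c1: "c1 > 0" using E'(2) by (simp add: c1_def)
  define X where "X = g\<^sub>0 ** E"
  define D where "D Y \<sigma> = det (mixed_columns J (\<lambda>j. column j Y) \<sigma>)"
    for Y :: "real^('m + 'n)^('m + 'n)" and \<sigma>
  \<comment> \<open>The coordinate of the flowed basis is computed twice: by the scaling of the
    flow, and by passing to the basis of \<open>span C\<close>. Only columns in \<open>J\<close>
    enter, so \<open>M l\<close> may be replaced by \<open>R l\<close>.\<close>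
  have D_eq: "exp (- (\<Sum>j\<in>-J. flow_weight (\<sigma> j)) * t l) * D X \<sigma> = D (G l ** E') \<sigma> * det (R l)" for l \<sigma>
  proof -
    have "diag_flow (t l) ** X = G l ** (E' ** M l)"
      using E'(2) by (simp add: X_def M_def matrix_mul_assoc eq matrix_inv_mult)
    moreover have "column j (G l ** (E' ** M l)) = column j ((G l ** E') ** R l)" if "j \<in> J" for j
      using that by (simp add: matrix_mul_assoc column_def matrix_matrix_mult_def[of "G l ** E'"] R_def)
    ultimately have "mixed_columns J (\<lambda>j. column j (diag_flow (t l) ** X)) \<sigma>
        = mixed_columns J (\<lambda>j. column j ((G l ** E') ** R l)) \<sigma>"
      by (simp add: mixed_columns_def cong: if_cong)
    also have "\<dots> = mixed_columns J (\<lambda>j. column j (G l ** E')) \<sigma> ** R l"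
      by (rule mixed_columns_mult) (auto simp: R_def blk)
    finally show ?thesis
      unfolding D_def det_mixed_columns_diag_flow[symmetric] by (simp add: det_mul)
  qed
  have lim: "(\<lambda>l. D (G l ** E') \<sigma>) \<longlonglongrightarrow> D (g ** E') \<sigma>" for \<sigma>
    unfolding D_def by (rule tendsto_mixed_columns[OF g(1)])
  have inj: "inj_on (\<lambda>j. column j (g ** E')) J" and ind: "independent ((\<lambda>j. column j (g ** E')) ` J)"
  proof -
    have img: "(\<lambda>j. column j (g ** E')) ` J = (*v) g ` C"
      unfolding E'(3)[symmetric] image_image
      by (simp only: column_eq_mult_axis matrix_vector_mul_assoc)
    have inj_g: "inj ((*v) g)"
      using g(2) by (metis invertible_det_nz inj_matrix_vector_mult zero_neq_one)
    show "independent ((\<lambda>j. column j (g ** E')) ` J)"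
      unfolding img using C(2) inj_g
      by (intro linear_independent_injective_image) (auto intro: inj_on_subset)
    have "card ((*v) g ` C) = card J"
      using J' inj_g by (simp add: card_image inj_on_subset)
    then show "inj_on (\<lambda>j. column j (g ** E')) J"
      by (intro eq_card_imp_inj_on) (simp_all add: img)
  qed
  \<comment> \<open>A coordinate that survives in the limit; its weight is the one that leads to the
    contradiction.\<close>
  obtain \<sigma> where \<sigma>: "D (g ** E') \<sigma> \<noteq> 0"
    using exists_mixed_columns_det_nonzero[OF inj ind] by (auto simp: D_def)
  \<comment> \<open>A coordinate vector occurring twice would make the determinant vanish. With
    injectivity the weights are summed over a genuine set of coordinates.\<close>
  have inj_\<sigma>: "inj_on \<sigma> (- J)"
  proof (rule inj_onI, rule ccontr)
    fix i j assume "i \<in> - J" "j \<in> - J" "\<sigma> i = \<sigma> j" "i \<noteq> j"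
    then have "D (g ** E') \<sigma> = 0"
      unfolding D_def by (intro det_identical_columns[of i j]) (auto simp: column_mixed_columns)
    with \<sigma> show False by simp
  qed
  \<comment> \<open>That set has \<open>d - card B\<close> elements, hence is neither empty nor
    everything, and coprimality applies.\<close>
  have "(\<Sum>i\<in>\<sigma> ` (- J). flow_weight i) \<noteq> 0"
  proof (rule sum_flow_weight_nonzero[OF cop])
    have "card (\<sigma> ` (- J)) = CARD('m + 'n) - card B"
      using inj_\<sigma> J by (simp add: card_image Compl_eq_Diff_UNIV card_Diff_subset)
    with B(3,4) show "\<sigma> ` (- J) \<noteq> {}" "\<sigma> ` (- J) \<noteq> UNIV" by auto
  qed
  then have w: "(\<Sum>j\<in>-J. flow_weight (\<sigma> j)) \<noteq> 0" (is "?w \<noteq> 0")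
    using inj_\<sigma> by (simp add: sum.reindex)
  show False
  proof (cases "?w > 0")
    \<comment> \<open>The left side of \<open>D_eq\<close> decays while \<open>det (R l)\<close>
      stays above \<open>c1\<close>, so the coordinate of the limit would be 0.\<close>
    case True
    have "filterlim (\<lambda>l. - ?w * t l) at_bot sequentially"
      by (rule filterlim_tendsto_neg_mult_at_bot[OF tendsto_const _ t]) (use True in simp)
    then have "(\<lambda>l. exp (- ?w * t l)) \<longlonglongrightarrow> 0"
      by (rule filterlim_compose[OF exp_at_bot])
    then have "(\<lambda>l. \<bar>exp (- ?w * t l) * D X \<sigma>\<bar> / c1) \<longlonglongrightarrow> \<bar>0 * D X \<sigma>\<bar> / c1"
      by (intro tendsto_intros) (use c1 in auto)
    then have lim0: "(\<lambda>l. \<bar>exp (- ?w * t l) * D X \<sigma>\<bar> / c1) \<longlonglongrightarrow> 0" by simp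
    have "norm (D (G l ** E') \<sigma>) \<le> \<bar>exp (- ?w * t l) * D X \<sigma>\<bar> / c1" for l
      using mult_left_mono[OF R(1)[of l], of "\<bar>D (G l ** E') \<sigma>\<bar>"] c1
      unfolding D_eq by (simp add: pos_le_divide_eq abs_mult)
    then have "(\<lambda>l. D (G l ** E') \<sigma>) \<longlonglongrightarrow> 0"
      by (intro Lim_null_comparison[OF always_eventually lim0]) blast
    with lim \<sigma> show False using LIMSEQ_unique by blast
  next
    \<comment> \<open>The exponential blows up while the right side of \<open>D_eq\<close> stays
      bounded. This forces \<open>D X \<sigma> = 0\<close>, hence all
      \<open>D (G l ** E') \<sigma>\<close> vanish, again against the nonzero limit.\<close>
    case False
    with w have neg: "?w < 0" by simp
    have "filterlim (\<lambda>l. - ?w * t l) at_top sequentially"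
      by (rule filterlim_tendsto_pos_mult_at_top[OF tendsto_const _ t]) (use neg in simp)
    then have "filterlim (\<lambda>l. exp (- ?w * t l)) at_top sequentially"
      by (rule filterlim_compose[OF exp_at_top])
    then have inv0: "(\<lambda>l. inverse (exp (- ?w * t l))) \<longlonglongrightarrow> 0"
      by (rule tendsto_inverse_0_at_top)
    have bound: "norm (D X \<sigma>) \<le> inverse (exp (- ?w * t l)) * (\<bar>D (G l ** E') \<sigma>\<bar> * c2)" for l
    proof -
      have "D X \<sigma> = inverse (exp (- ?w * t l)) * (D (G l ** E') \<sigma> * det (R l))"
        unfolding D_eq[symmetric] by (simp add: mult.assoc[symmetric])
      then have "norm (D X \<sigma>) = inverse (exp (- ?w * t l)) * (\<bar>D (G l ** E') \<sigma>\<bar> * \<bar>det (R l)\<bar>)"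
        by (metis abs_mult abs_of_pos exp_gt_zero positive_imp_inverse_positive real_norm_def)
      also have "\<dots> \<le> inverse (exp (- ?w * t l)) * (\<bar>D (G l ** E') \<sigma>\<bar> * c2)"
        by (intro mult_left_mono R) auto
      finally show ?thesis .
    qed
    have "(\<lambda>l. inverse (exp (- ?w * t l)) * (\<bar>D (G l ** E') \<sigma>\<bar> * c2)) \<longlonglongrightarrow> 0 * (\<bar>D (g ** E') \<sigma>\<bar> * c2)"
      by (intro tendsto_intros inv0 lim)
    then have "norm (D X \<sigma>) \<le> 0"
      using bound by (intro LIMSEQ_le_const[where X = "\<lambda>l. inverse (exp (- ?w * t l)) * (\<bar>D (G l ** E') \<sigma>\<bar> * c2)"]) auto
    then have "D (G l ** E') \<sigma> = 0" for l
      using D_eq[of \<sigma> l] R(1)[of l] c1 by auto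
    with lim[of \<sigma>] \<sigma> show False by (simp add: LIMSEQ_const_iff)
  qed
qed

section \<open>Frequencies annihilating a sequence of subspaces\<close>

text \<open>Take \<open>B\<close> of largest size among independent integral sets annihilating
  infinitely many \<open>U l\<close>, and let \<open>r\<close> enumerate those indices. A further
  frequency annihilating infinitely many \<open>U (r l)\<close> could be adjoined to
  \<open>B\<close>, against maximality.\<close>

lemma exists_maximal_limit_annihilator:
  fixes U :: "nat \<Rightarrow> (real^'d) set"
  obtains B r where "B \<subseteq> integer_vectors" "independent B" "strict_mono (r :: nat \<Rightarrow> nat)"
    "\<forall>l. \<forall>w \<in> span B. \<forall>u \<in> U (r l). w \<bullet> u = 0"
    "\<forall>\<xi> \<in> integer_vectors - span B. \<forall>\<^sub>F l in sequentially. \<exists>u \<in> U (r l). \<xi> \<bullet> u \<noteq> 0"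
proof -
  define good where "good B \<longleftrightarrow> B \<subseteq> integer_vectors \<and> independent B \<and>
      infinite {l. \<forall>w\<in>span B. \<forall>u\<in>U l. w \<bullet> u = 0}" for B :: "(real^'d) set"
  have "good {}" by (simp add: good_def independent_empty)
  moreover have "card B < Suc CARD('d)" if "good B" for B
    using dim_eq_card_independent[of B] dim_subset_UNIV[of B] that by (simp add: good_def)
  ultimately obtain B where B: "good B" "\<And>B'. good B' \<Longrightarrow> card B' \<le> card B"
    using ex_has_greatest_nat[of good "{}" card "Suc CARD('d)"] by (metis less_or_eq_imp_le)
  define r where "r = enumerate {l. \<forall>w\<in>span B. \<forall>u\<in>U l. w \<bullet> u = 0}"
  have inf: "infinite {l. \<forall>w\<in>span B. \<forall>u\<in>U l. w \<bullet> u = 0}" using B(1) by (simp add: good_def)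
  show thesis
  proof
    show "B \<subseteq> integer_vectors" "independent B" using B(1) by (auto simp: good_def)
    show r: "strict_mono r" unfolding r_def using inf by (rule strict_mono_enumerate)
    show perp: "\<forall>l. \<forall>w \<in> span B. \<forall>u \<in> U (r l). w \<bullet> u = 0"
      using enumerate_in_set[OF inf] by (auto simp: r_def)
    show "\<forall>\<xi> \<in> integer_vectors - span B. \<forall>\<^sub>F l in sequentially. \<exists>u \<in> U (r l). \<xi> \<bullet> u \<noteq> 0"
    proof (intro ballI, rule ccontr)
      fix \<xi> assume "\<xi> \<in> integer_vectors - span B"
      then have \<xi>: "\<xi> \<in> integer_vectors" "\<xi> \<notin> span B" by auto
      assume "\<not> (\<forall>\<^sub>F l in sequentially. \<exists>u \<in> U (r l). \<xi> \<bullet> u \<noteq> 0)"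
      then have "infinite {l. \<forall>u\<in>U (r l). \<xi> \<bullet> u = 0}"
        by (simp add: cofinite_eq_sequentially[symmetric] eventually_cofinite)
      then have "infinite (r ` {l. \<forall>u\<in>U (r l). \<xi> \<bullet> u = 0})"
        using r strict_mono_imp_inj_on finite_imageD inj_on_subset by blast
      moreover have "r ` {l. \<forall>u\<in>U (r l). \<xi> \<bullet> u = 0} \<subseteq> {l. \<forall>w\<in>span (insert \<xi> B). \<forall>u\<in>U l. w \<bullet> u = 0}"
      proof clarify
        fix l w u assume l: "\<forall>u\<in>U (r l). \<xi> \<bullet> u = 0" and w: "w \<in> span (insert \<xi> B)" and u: "u \<in> U (r l)"
        from w obtain a where "w - a *\<^sub>R \<xi> \<in> span B" by (auto simp: span_breakdown_eq)
        then have "(w - a *\<^sub>R \<xi>) \<bullet> u = 0" using perp u by blast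
        with l u show "w \<bullet> u = 0" by (simp add: inner_diff_left)
      qed
      ultimately have "infinite {l. \<forall>w\<in>span (insert \<xi> B). \<forall>u\<in>U l. w \<bullet> u = 0}"
        using finite_subset by blast
      moreover have "independent (insert \<xi> B)"
        using \<xi>(2) B(1) by (simp add: good_def independent_insertI)
      ultimately have "good (insert \<xi> B)" using B(1) \<xi>(1) by (simp add: good_def)
      then have "card (insert \<xi> B) \<le> card B" by (rule B(2))
      moreover have "finite B" using B(1) by (simp add: good_def independent_imp_finite)
      ultimately show False using \<xi>(2) span_base by (auto simp: card_insert_if split: if_splits)
    qed
  qed
qed

section \<open>Lattices and functions on a torus fibre\<close>

text \<open>Distinct integral matrices have distance at least 1, so no set of them has an
  accumulation point.\<close>

lemma closed_int_matrix_set: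
  assumes "S \<subseteq> {A :: real^'n^'m. int_matrix A}"
  shows "closed S"
proof (rule discrete_imp_closed[of 1])
  show "\<forall>A\<in>S. \<forall>B\<in>S. dist B A < 1 \<longrightarrow> B = A"
  proof (intro ballI impI)
    fix A B assume AB: "A \<in> S" "B \<in> S" "dist B A < 1"
    have "B $ i $ j = A $ i $ j" for i j
    proof -
      have "\<bar>(B - A) $ i $ j\<bar> \<le> norm (B - A)"
        using component_le_norm_cart[of "(B - A) $ i" j] Finite_Cartesian_Product.norm_nth_le[of "B - A" i]
        by linarith
      then have "\<bar>B $ i $ j - A $ i $ j\<bar> < 1" using AB(3) by (simp add: dist_norm)
      moreover have "B $ i $ j - A $ i $ j \<in> \<int>"
        using AB(1,2) assms by (intro Ints_diff) (auto simp: int_matrix_def subset_iff)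
      ultimately show ?thesis using Ints_nonzero_abs_less1[of "B $ i $ j - A $ i $ j"] by simp
    qed
    then show "B = A" by (simp add: vec_eq_iff)
  qed
qed simp

lemma closed_integer_vectors: "closed (integer_vectors :: (real^'d) set)"
proof -
  have eq: "integer_vectors = (\<Inter>i. {v :: real^'d. v $ i \<in> \<int>})"
    by (auto simp: integer_vectors_def)
  have "closed {v :: real^'d. v $ i \<in> \<int>}" for i
    using closed_vimage[OF closed_Ints, of "\<lambda>v :: real^'d. v $ i"]
    by (simp add: vimage_def continuous_intros)
  then show ?thesis unfolding eq by (intro closed_INT) blast
qed

section \<open>Lattices and their translates\<close>

lemma lattice_of_mult: "lattice_of (A ** B) = (*v) A ` lattice_of B"
  by (simp add: lattice_of_def image_image matrix_vector_mul_assoc)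

lemma lattice_ofI: "p \<in> integer_vectors \<Longrightarrow> g *v p \<in> lattice_of g"
  by (simp add: lattice_of_def)

lemma zero_in_lattice_of [simp]: "0 \<in> lattice_of g"
  unfolding lattice_of_def by (metis imageI matrix_vector_mult_0_right zero_in_integer_vectors)

lemma lattice_of_add: "p \<in> lattice_of g \<Longrightarrow> q \<in> lattice_of g \<Longrightarrow> p + q \<in> lattice_of g"
  by (auto simp: lattice_of_def matrix_vector_right_distrib[symmetric] intro!: imageI integer_vectors_add)

lemma lattice_of_uminus: "p \<in> lattice_of g \<Longrightarrow> - p \<in> lattice_of g"
  using integer_vectors_uminus by (force simp: lattice_of_def mult_minus_left vec.neg[symmetric])

lemma translate_eq_lattice_of:
  assumes "p \<in> lattice_of g"
  shows "(+) (v + p) ` lattice_of g = (+) v ` lattice_of g"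
proof -
  have "(+) p ` lattice_of g = lattice_of g"
  proof (intro equalityI subsetI)
    fix q assume "q \<in> lattice_of g"
    then have "q = p + (- p + q)" "- p + q \<in> lattice_of g"
      using assms by (simp, blast intro: lattice_of_add lattice_of_uminus)
    then show "q \<in> (+) p ` lattice_of g" by blast
  qed (auto intro: lattice_of_add assms)
  moreover have "(+) (v + p) ` lattice_of g = (+) v ` ((+) p ` lattice_of g)"
    by (simp add: image_image add.assoc)
  ultimately show ?thesis by simp
qed

lemma int_matrix_if_lattice_of_subset:
  fixes g h :: "real^'d^'d"
  assumes "lattice_of h \<subseteq> lattice_of g" "det g \<noteq> 0"
  shows "int_matrix (matrix_inv g ** h)"
proof (rule int_matrixI)
  fix v :: "real^'d" assume "v \<in> integer_vectors"
  then have "h *v v \<in> lattice_of g" using assms(1) lattice_ofI by blast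
  then obtain p where "p \<in> integer_vectors" "h *v v = g *v p" by (auto simp: lattice_of_def)
  then show "(matrix_inv g ** h) *v v \<in> integer_vectors"
    using assms(2) by (simp add: matrix_vector_mul_assoc[symmetric] matrix_inv_mult_vec)
qed

lemma lattice_of_in_topspace: "det g = 1 \<Longrightarrow> lattice_of g \<in> topspace lattice_space"
  by (auto simp: topspace_lattice_space)

section \<open>Closed and Borel sets of grids\<close>

lemma continuous_on_matrix_mult_left: "continuous_on S (\<lambda>h. A ** h)" for A :: "real^'n^'m"
  unfolding matrix_matrix_mult_def by (intro continuous_intros)

lemma continuous_on_matrix_vector_mult:
  "continuous_on S f \<Longrightarrow> continuous_on S h \<Longrightarrow> continuous_on S (\<lambda>x. f x *v h x)"
  for f :: "_ \<Rightarrow> real^'n^'m"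
  unfolding matrix_vector_mult_def by (intro continuous_intros)

text \<open>Multiplication by the inverse of \<open>g\<close> carries the fibre to a set of integral
  matrices.\<close>

lemma closed_lattice_of_fibre:
  fixes g :: "real^'d^'d"
  assumes "det g = 1"
  shows "closed {h. det h = 1 \<and> lattice_of h = lattice_of g}"
proof -
  define S where "S = {\<gamma>. det (g ** \<gamma>) = 1 \<and> lattice_of (g ** \<gamma>) = lattice_of g}"
  have "int_matrix \<gamma>" if "\<gamma> \<in> S" for \<gamma>
  proof -
    have "int_matrix (matrix_inv g ** (g ** \<gamma>))"
      using that assms by (intro int_matrix_if_lattice_of_subset) (auto simp: S_def)
    then show ?thesis using assms by (simp add: matrix_inv_mult_mat)
  qed
  then have "closed S" by (intro closed_int_matrix_set) auto
  then have "closed ((\<lambda>h. matrix_inv g ** h) -` S)"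
    by (rule closed_vimage) (rule continuous_on_matrix_mult_left)
  moreover have "(\<lambda>h. matrix_inv g ** h) -` S = {h. det h = 1 \<and> lattice_of h = lattice_of g}"
    using assms by (auto simp: S_def matrix_inv_mult_mat)
  ultimately show ?thesis by simp
qed

text \<open>Closedness in the quotient is tested on the preimage, and periodicity of
  \<open>D\<close> makes that preimage the product of a closed fibre of \<open>lattice_of\<close>
  with \<open>D\<close>. This is the source of all Borel sets of grids needed below.\<close>

lemma closedin_torus_image:
  assumes g: "det g = 1" and D: "closed D" "\<And>v p. v \<in> D \<Longrightarrow> p \<in> lattice_of g \<Longrightarrow> v + p \<in> D"
  shows "closedin grid_space ((\<lambda>v. (+) v ` lattice_of g) ` D)"
proof -
  let ?V = "(\<lambda>v. (+) v ` lattice_of g) ` D"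
  have pre: "{p \<in> topspace ASL_top. grid_of p \<in> ?V} = {h. det h = 1 \<and> lattice_of h = lattice_of g} \<times> D"
  proof (intro equalityI subsetI)
    fix p assume "p \<in> {p \<in> topspace ASL_top. grid_of p \<in> ?V}"
    then obtain h v w where p: "p = (h, v)" "det h = 1" "w \<in> D"
      and eq: "(+) v ` lattice_of h = (+) w ` lattice_of g"
      by (cases p) (auto simp: ASL_top_def grid_of_def)
    have "lattice_of h = lattice_of g"
      using grid_lattice_translate[OF lattice_of_in_topspace] p(2) g eq by metis
    moreover have "v + 0 \<in> (+) v ` lattice_of h" by (rule imageI) simp
    then have "v \<in> D" using eq D(2) p(3) by auto
    ultimately show "p \<in> {h. det h = 1 \<and> lattice_of h = lattice_of g} \<times> D" using p by simp
  qed (auto simp: ASL_top_def grid_of_def)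
  have cl: "closedin ASL_top ({h. det h = 1 \<and> lattice_of h = lattice_of g} \<times> D)"
    unfolding ASL_top_def
    by (intro closed_subset closed_Times closed_lattice_of_fibre g D(1)) auto
  have "?V \<subseteq> topspace grid_space"
    using g by (auto simp: topspace_grid_space intro: lattice_of_in_topspace)
  then have "closedin ASL_top {p \<in> topspace ASL_top. grid_of p \<in> ?V} = closedin grid_space ?V"
    using quotient_map_quotient_top[of ASL_top grid_of]
    unfolding quotient_map_closedin grid_space_def[symmetric] by blast
  with cl show ?thesis by (simp only: pre)
qed

lemma sets_borel_sigma_closedin:
  assumes "closedin T V"
  shows "V \<in> sets (borel_sigma T)"
proof -
  have "topspace T - V \<in> sets (borel_sigma T)"
    using assms by (auto simp: sets_borel_sigma closedin_def intro: sigma_sets.Basic)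
  then have "space (borel_sigma T) - (topspace T - V) \<in> sets (borel_sigma T)"
    by (rule sets.compl_sets)
  then show ?thesis
    using closedin_subset[OF assms] by (simp add: double_diff)
qed

lemma borel_sigma_euclidean: "borel_sigma euclidean = borel"
  by (simp add: borel_sigma_def borel_def)

text \<open>The representative is arbitrary: it is only used for functions that are periodic modulo the
  lattice.\<close>

definition torus_fun :: "(real^'d) set \<Rightarrow> (real^'d \<Rightarrow> real) \<Rightarrow> (real^'d) set \<Rightarrow> real" where
  "torus_fun x \<phi> z = (if z \<in> lattice_torus x then \<phi> (SOME v. v \<in> z) else 0)"

lemma torus_fun_translate:
  assumes "det g = 1" "\<And>v p. p \<in> lattice_of g \<Longrightarrow> \<phi> (v + p) = \<phi> v"
  shows "torus_fun (lattice_of g) \<phi> ((+) v ` lattice_of g) = \<phi> v"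
proof -
  have "v + 0 \<in> (+) v ` lattice_of g" by (rule imageI) simp
  then have "(SOME w. w \<in> (+) v ` lattice_of g) \<in> (+) v ` lattice_of g" by (rule someI)
  then show ?thesis
    using assms by (auto simp: torus_fun_def lattice_torus_eq lattice_of_in_topspace)
qed

text \<open>On the fibre, the preimage of an open set is what remains after removing the image of a
  closed periodic set. The fibre and that image are both closed in the space of grids.\<close>

lemma borel_measurable_torus_fun:
  assumes g: "det g = 1" and \<phi>: "continuous_on UNIV \<phi>"
    "\<And>v p. p \<in> lattice_of g \<Longrightarrow> \<phi> (v + p) = \<phi> v"
  shows "torus_fun (lattice_of g) \<phi> \<in> borel_measurable (borel_sigma grid_space)"
proof (rule borel_measurableI)
  fix S :: "real set" assume "open S"
  let ?x = "lattice_of g" and ?M = "borel_sigma grid_space"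
  let ?I = "\<lambda>D. (\<lambda>v. (+) v ` ?x) ` D"
  have torus: "lattice_torus ?x = range (\<lambda>v. (+) v ` ?x)"
    by (rule lattice_torus_eq[OF lattice_of_in_topspace[OF g]])
  have "closedin grid_space (lattice_torus ?x)"
    unfolding torus by (rule closedin_torus_image[OF g]) auto
  then have T: "lattice_torus ?x \<in> sets ?M" by (rule sets_borel_sigma_closedin)
  have "closed (\<phi> -` (- S))" using \<open>open S\<close> \<phi>(1) by (intro closed_vimage) auto
  then have "closedin grid_space (?I (\<phi> -` (- S)))"
    by (rule closedin_torus_image[OF g]) (auto simp: \<phi>(2))
  then have C: "?I (\<phi> -` (- S)) \<in> sets ?M" by (rule sets_borel_sigma_closedin)
  \<comment> \<open>The second part of the union accounts for the default value 0 off the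
    fibre.\<close>
  have "torus_fun ?x \<phi> -` S \<inter> space ?M
      = (lattice_torus ?x - ?I (\<phi> -` (- S))) \<union> (if 0 \<in> S then space ?M - lattice_torus ?x else {})"
  proof (intro set_eqI)
    fix z
    show "z \<in> torus_fun ?x \<phi> -` S \<inter> space ?M \<longleftrightarrow>
      z \<in> (lattice_torus ?x - ?I (\<phi> -` (- S))) \<union> (if 0 \<in> S then space ?M - lattice_torus ?x else {})"
    proof (cases "z \<in> lattice_torus ?x")
      case True
      then obtain v where z: "z = (+) v ` ?x" unfolding torus by blast
      have eq: "\<phi> w = \<phi> v" if "z = (+) w ` ?x" for w
        using that z torus_fun_translate[OF g \<phi>(2)] by metis
      have "z \<in> space ?M" using True by (simp add: lattice_torus_def)
      moreover have "torus_fun ?x \<phi> z = \<phi> v" by (simp add: z torus_fun_translate[OF g \<phi>(2)])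
      moreover have "z \<in> ?I (\<phi> -` (- S)) \<longleftrightarrow> (\<exists>w. \<phi> w \<notin> S \<and> z = (+) w ` ?x)" by auto
      then have "z \<in> ?I (\<phi> -` (- S)) \<longleftrightarrow> \<phi> v \<notin> S" using z eq by metis
      ultimately show ?thesis using True by simp
    qed (auto simp: torus_fun_def torus)
  qed
  also have "\<dots> \<in> sets ?M" using T C by (auto simp del: space_borel_sigma)
  finally show "torus_fun ?x \<phi> -` S \<inter> space ?M \<in> sets ?M" .
qed

section \<open>Fourier coefficients and trigonometric polynomials\<close>

lemma cos_add_Ints: "n \<in> \<int> \<Longrightarrow> cos (x + 2 * pi * n) = cos x" for x n :: real
  by (elim Ints_cases) (simp add: cos_add cos_int_2pin sin_int_2pin)

text \<open>Measurability of \<open>A\<close> is implicit, since \<open>emeasure\<close> takes the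
  default value 0 on sets that are not measurable.\<close>

lemma AE_in_if_emeasure_eq_1:
  assumes "prob_space \<mu>" "emeasure \<mu> A = 1"
  shows "AE z in \<mu>. z \<in> A"
proof -
  interpret prob_space \<mu> by (rule assms)
  show ?thesis using assms(2) by (intro AE_prob_1) (simp add: measure_def)
qed

lemma integrable_torus_fun:
  assumes "det g = 1" "prob_space \<mu>" "sets \<mu> = sets (borel_sigma grid_space)"
    and "continuous_on UNIV \<phi>" "\<And>v p. p \<in> lattice_of g \<Longrightarrow> \<phi> (v + p) = \<phi> v" "\<And>v. \<bar>\<phi> v\<bar> \<le> b"
  shows "integrable \<mu> (torus_fun (lattice_of g) \<phi>)"
proof -
  interpret prob_space \<mu> by (rule assms)
  have "torus_fun (lattice_of g) \<phi> \<in> borel_measurable \<mu>"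
    using borel_measurable_torus_fun[OF assms(1,4,5)] measurable_cong_sets[OF assms(3) refl] by blast
  moreover have "\<bar>torus_fun (lattice_of g) \<phi> z\<bar> \<le> max b 0" for z
    using assms(6)[of "SOME v. v \<in> z"] by (auto simp: torus_fun_def)
  ultimately show ?thesis by (intro integrable_const_bound[where B = "max b 0"]) auto
qed

text \<open>If \<open>\<eta>\<close> is not orthogonal to \<open>U\<close>, then translating by some \<open>u \<in> U\<close> with
  \<open>\<eta> \<bullet> u = 1 / 2\<close> preserves the measure and changes the sign of the integrand.\<close>

lemma integral_wave:
  fixes \<eta> v\<^sub>0 :: "real^'d"
  assumes g: "det g = 1" and \<mu>: "prob_space \<mu>" "sets \<mu> = sets (borel_sigma grid_space)"
    and U: "subspace U"
    and supp: "emeasure \<mu> ((\<lambda>u. (+) u ` ((+) v\<^sub>0 ` lattice_of g)) ` U) = 1"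
    and inv: "\<And>u. u \<in> U \<Longrightarrow> distr \<mu> (borel_sigma grid_space) ((`) ((+) u)) = \<mu>"
    and \<eta>: "\<And>p. p \<in> lattice_of g \<Longrightarrow> \<eta> \<bullet> p \<in> \<int>"
  shows "(\<integral>z. torus_fun (lattice_of g) (\<lambda>v. cos (2 * pi * (\<eta> \<bullet> v) + c)) z \<partial>\<mu>)
    = (if \<forall>u\<in>U. \<eta> \<bullet> u = 0 then cos (2 * pi * (\<eta> \<bullet> v\<^sub>0) + c) else 0)"
proof -
  interpret prob_space \<mu> by (rule \<mu>)
  let ?x = "lattice_of g"
  define \<phi> where "\<phi> v = cos (2 * pi * (\<eta> \<bullet> v) + c)" for v
  define W where "W = torus_fun ?x \<phi>"
  have per: "\<phi> (v + p) = \<phi> v" if "p \<in> ?x" for v p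
    using cos_add_Ints[OF \<eta>[OF that], of "2 * pi * (\<eta> \<bullet> v) + c"]
    by (simp add: \<phi>_def inner_right_distrib algebra_simps)
  have cont: "continuous_on UNIV \<phi>" unfolding \<phi>_def by (intro continuous_intros)
  have W: "W ((+) v ` ?x) = \<phi> v" for v
    unfolding W_def by (rule torus_fun_translate[where \<phi> = \<phi>, OF g per])
  have W_meas: "W \<in> borel_measurable (borel_sigma grid_space)"
    unfolding W_def by (rule borel_measurable_torus_fun[where \<phi> = \<phi>, OF g cont per])
  then have [measurable]: "W \<in> borel_measurable \<mu>"
    using measurable_cong_sets[OF \<mu>(2) refl] by blast
  have AE: "AE z in \<mu>. \<exists>u\<in>U. z = (+) (u + v\<^sub>0) ` ?x"
    using AE_in_if_emeasure_eq_1[OF \<mu>(1) supp]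
    by eventually_elim (auto simp: image_image add.assoc)
  have "(\<integral>z. W z \<partial>\<mu>) = (if \<forall>u\<in>U. \<eta> \<bullet> u = 0 then \<phi> v\<^sub>0 else 0)"
  proof (cases "\<forall>u\<in>U. \<eta> \<bullet> u = 0")
    case True
    have "(\<integral>z. W z \<partial>\<mu>) = (\<integral>z. \<phi> v\<^sub>0 \<partial>\<mu>)"
    proof (rule integral_cong_AE)
      show "AE z in \<mu>. W z = \<phi> v\<^sub>0"
        using AE by eventually_elim (use True in \<open>auto simp: W \<phi>_def inner_right_distrib\<close>)
    qed simp_all
    then show ?thesis using True by (simp add: prob_space)
  next
    case False
    then obtain u\<^sub>1 where u\<^sub>1: "u\<^sub>1 \<in> U" "\<eta> \<bullet> u\<^sub>1 \<noteq> 0" by auto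
    define u where "u = (1 / (2 * (\<eta> \<bullet> u\<^sub>1))) *\<^sub>R u\<^sub>1"
    have u: "u \<in> U" "\<eta> \<bullet> u = 1 / 2"
      using u\<^sub>1 U by (auto simp: u_def subspace_scale)
    have tr: "(`) ((+) u) \<in> measurable \<mu> (borel_sigma grid_space)"
      using measurable_borel_sigma[OF continuous_map_translation_grid_space, of u]
        measurable_cong_sets[OF \<mu>(2) refl] by blast
    have "(\<integral>z. W z \<partial>\<mu>) = (\<integral>z. W z \<partial>(distr \<mu> (borel_sigma grid_space) ((`) ((+) u))))"
      by (simp add: inv u)
    also have "\<dots> = (\<integral>z. W ((+) u ` z) \<partial>\<mu>)"
      by (rule integral_distr[OF tr W_meas])
    also have "\<dots> = (\<integral>z. - W z \<partial>\<mu>)"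
    proof (rule integral_cong_AE)
      show "(\<lambda>z. W ((+) u ` z)) \<in> borel_measurable \<mu>"
        using measurable_compose[OF tr W_meas] .
      show "AE z in \<mu>. W ((+) u ` z) = - W z"
        using AE
      proof eventually_elim
        case (elim z)
        then obtain w where z: "z = (+) w ` ?x" by blast
        have "W ((+) u ` z) = \<phi> (u + w)"
          unfolding z image_image by (simp add: add.assoc[symmetric] W)
        also have "\<dots> = cos ((2 * pi * (\<eta> \<bullet> w) + c) + pi)"
          unfolding \<phi>_def by (simp add: inner_right_distrib u algebra_simps)
        also have "\<dots> = - W z" by (simp add: z W \<phi>_def)
        finally show ?case .
      qed
    qed simp
    finally have "(\<integral>z. W z \<partial>\<mu>) = 0" by simp
    with u\<^sub>1 show ?thesis by auto
  qed
  then show ?thesis by (simp add: W_def \<phi>_def[abs_def])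
qed

text \<open>The phase \<open>c\<close> lets one real generator produce cosines, sines and constants,
  so that Fourier analysis stays real-valued.\<close>

inductive trig_poly :: "(real^'d \<Rightarrow> real) \<Rightarrow> bool" where
  wave: "\<xi> \<in> integer_vectors \<Longrightarrow> trig_poly (\<lambda>v. cos (2 * pi * (\<xi> \<bullet> v) + c))"
| add: "trig_poly p \<Longrightarrow> trig_poly q \<Longrightarrow> trig_poly (\<lambda>v. p v + q v)"
| scale: "trig_poly p \<Longrightarrow> trig_poly (\<lambda>v. a * p v)"

lemma trig_poly_const: "trig_poly (\<lambda>v. a)"
  using trig_poly.scale[OF trig_poly.wave[of 0 0], of a] by simp

lemma trig_poly_sum: "finite I \<Longrightarrow> (\<And>i. i \<in> I \<Longrightarrow> trig_poly (p i)) \<Longrightarrow> trig_poly (\<lambda>v. \<Sum>i\<in>I. p i v)"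
  by (induction rule: finite_induct) (auto intro: trig_poly_const trig_poly.add)

text \<open>The product formula for cosines turns a product of two waves into waves at the
  difference and the sum of their frequencies, which are again integral.\<close>

lemma trig_poly_wave_mult:
  assumes "trig_poly q" "\<xi> \<in> integer_vectors"
  shows "trig_poly (\<lambda>v. cos (2 * pi * (\<xi> \<bullet> v) + c) * q v)"
  using assms(1)
proof induction
  case (wave \<zeta> b)
  have "trig_poly (\<lambda>v. (1/2) * (cos (2 * pi * ((\<xi> - \<zeta>) \<bullet> v) + (c - b)) + cos (2 * pi * ((\<xi> + \<zeta>) \<bullet> v) + (c + b))))"
    using wave assms(2)
    by (intro trig_poly.intros integer_vectors_add integer_vectors_diff)
  also have "(\<lambda>v. (1/2) * (cos (2 * pi * ((\<xi> - \<zeta>) \<bullet> v) + (c - b)) + cos (2 * pi * ((\<xi> + \<zeta>) \<bullet> v) + (c + b))))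
      = (\<lambda>v. cos (2 * pi * (\<xi> \<bullet> v) + c) * cos (2 * pi * (\<zeta> \<bullet> v) + b))"
    unfolding cos_times_cos by (rule ext) (simp add: inner_add_left inner_diff_left algebra_simps)
  finally show ?case .
next
  case (add p q)
  from trig_poly.add[OF add.IH] show ?case by (simp add: distrib_left)
next
  case (scale p a)
  from trig_poly.scale[OF scale.IH, of a] show ?case by (simp add: mult_ac)
qed

lemma trig_poly_mult: "trig_poly p \<Longrightarrow> trig_poly q \<Longrightarrow> trig_poly (\<lambda>v. p v * q v)"
proof (induction rule: trig_poly.induct)
  case (wave \<xi> c)
  then show ?case by (simp add: trig_poly_wave_mult)
next
  case (add p q')
  from trig_poly.add[OF add.IH(1)[OF add.prems] add.IH(2)[OF add.prems]]
  show ?case by (simp add: distrib_right)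
next
  case (scale p a)
  from trig_poly.scale[OF scale.IH[OF scale.prems], of a] show ?case by (simp add: mult_ac)
qed

lemma trig_poly_cos_axis: "trig_poly (\<lambda>v. cos (2 * pi * v $ i))"
  and trig_poly_sin_axis: "trig_poly (\<lambda>v. sin (2 * pi * v $ i))"
proof -
  show "trig_poly (\<lambda>v. cos (2 * pi * v $ i))"
    using trig_poly.wave[of "axis i 1" 0] by (simp add: inner_axis')
  have "cos (x + - (pi / 2)) = sin x" for x :: real by (simp add: cos_diff)
  then show "trig_poly (\<lambda>v. sin (2 * pi * v $ i))"
    using trig_poly.wave[of "axis i 1" "- (pi / 2)"] by (simp add: inner_axis')
qed

text \<open>Realises the standard torus as a compact subset of a finite-dimensional space, where
  Stone-Weierstrass for polynomials is available.\<close>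

definition torus_embedding :: "real^'d \<Rightarrow> complex^'d" where
  "torus_embedding v = (\<chi> i. cis (2 * pi * v $ i))"

lemma continuous_on_torus_embedding: "continuous_on S torus_embedding"
  unfolding torus_embedding_def cis_conv_exp by (intro continuous_intros)

lemma torus_embedding_eq_iff:
  "torus_embedding v = torus_embedding w \<longleftrightarrow> v - w \<in> integer_vectors"
proof -
  have "cis (2 * pi * a) = cis (2 * pi * b) \<longleftrightarrow> a - b \<in> \<int>" for a b :: real
  proof -
    have "cis (2 * pi * a) = cis (2 * pi * b) \<longleftrightarrow> cis (2 * pi * a - 2 * pi * b) = 1"
      by (simp add: cis_divide[symmetric])
    also have "\<dots> \<longleftrightarrow> cos (2 * pi * (a - b)) = 1"
    proof -
      have "sin (2 * pi * (a - b)) = 0" if "cos (2 * pi * (a - b)) = 1"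
        using sin_cos_squared_add[of "2 * pi * (a - b)"] that by simp
      then show ?thesis by (auto simp: complex_eq_iff algebra_simps)
    qed
    also have "\<dots> \<longleftrightarrow> (\<exists>n::int. a - b = of_int n)"
      by (auto simp: cos_one_2pi_int)
    also have "\<dots> \<longleftrightarrow> a - b \<in> \<int>" by (auto simp: Ints_def)
    finally show ?thesis .
  qed
  then show ?thesis by (simp add: torus_embedding_def vec_eq_iff integer_vectors_def)
qed

text \<open>A real-linear function of the embedding is a combination of the cosines and sines of the
  coordinates; constants, sums and products stay among the trigonometric polynomials.\<close>

lemma trig_poly_polynomial_torus_embedding:
  fixes p :: "complex^'d \<Rightarrow> real"
  assumes "real_polynomial_function p"
  shows "trig_poly (\<lambda>v. p (torus_embedding v))"
  using assms
proof induction
  case (linear f)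
  interpret bounded_linear f by fact
  have "torus_embedding v = (\<Sum>i\<in>UNIV. cos (2 * pi * v $ i) *\<^sub>R axis i 1 + sin (2 * pi * v $ i) *\<^sub>R axis i \<i>)"
    for v :: "real^'d"
    by (simp add: torus_embedding_def vec_eq_iff axis_def complex_eq_iff if_distrib cong: if_cong)
  then have "f (torus_embedding v) = (\<Sum>i\<in>UNIV. f (axis i 1) * cos (2 * pi * v $ i) + f (axis i \<i>) * sin (2 * pi * v $ i))"
    for v :: "real^'d"
    by (simp add: sum add scaleR mult.commute)
  moreover have "trig_poly (\<lambda>v. \<Sum>i\<in>UNIV. f (axis i 1) * cos (2 * pi * v $ i) + f (axis i \<i>) * sin (2 * pi * v $ i))"
    by (intro trig_poly_sum trig_poly.add trig_poly.scale trig_poly_cos_axis trig_poly_sin_axis) auto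
  ultimately show ?case by simp
qed (auto intro: trig_poly_const trig_poly.add trig_poly_mult)

section \<open>Uniform approximation of periodic functions\<close>

lemma exists_cube_representative:
  fixes v :: "real^'d"
  obtains p where "p \<in> integer_vectors" "v - p \<in> cbox 0 1"
proof
  show "(\<chi> i. of_int \<lfloor>v $ i\<rfloor>) \<in> integer_vectors" by (simp add: integer_vectors_def)
  show "v - (\<chi> i. of_int \<lfloor>v $ i\<rfloor>) \<in> cbox 0 1"
    by (auto simp: mem_box_cart) linarith+
qed

text \<open>A continuous periodic function descends to a continuous function \<open>G\<close> on the
  compact image \<open>K\<close> of the torus. A polynomial close to \<open>G\<close> on
  \<open>K\<close> pulls back to a trigonometric polynomial.\<close>

lemma trig_poly_dense:
  fixes F :: "real^'d \<Rightarrow> real"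
  assumes F: "continuous_on UNIV F" "\<And>v p. p \<in> integer_vectors \<Longrightarrow> F (v + p) = F v" and "e > 0"
  obtains P where "trig_poly P" "\<And>v. \<bar>F v - P v\<bar> < e"
proof -
  let ?E = "torus_embedding :: real^'d \<Rightarrow> _"
  define K where "K = ?E ` cbox 0 1"
  have E_K: "?E v \<in> K" for v
  proof -
    obtain p where p: "p \<in> integer_vectors" "v - p \<in> cbox 0 1" by (rule exists_cube_representative)
    then have "?E v = ?E (v - p)" by (simp add: torus_embedding_eq_iff)
    then show ?thesis using p by (auto simp: K_def)
  qed
  define G where "G k = F (SOME v. ?E v = k)" for k
  have GE: "G (?E v) = F v" for v
  proof -
    have "?E (SOME w. ?E w = ?E v) = ?E v" by (rule someI) simp
    then have "(SOME w. ?E w = ?E v) - v \<in> integer_vectors" by (simp add: torus_embedding_eq_iff)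
    then show ?thesis using F(2)[of "(SOME w. ?E w = ?E v) - v" v] by (simp add: G_def)
  qed
  have compact: "compact (?E ` T)" if "compact T" for T
    using continuous_on_torus_embedding that by (rule compact_continuous_image)
  then have K: "compact K" unfolding K_def by (intro compact) auto
  \<comment> \<open>\<open>G\<close> is defined by choosing representatives, so continuity is shown
    through closed sets: their preimages in \<open>K\<close> are images of compact parts of the unit
    cube.\<close>
  have "continuous_on K G"
    unfolding continuous_on_closed_vimage[OF compact_imp_closed[OF K]]
  proof (intro allI impI)
    fix B :: "real set" assume "closed B"
    then have "closed (F -` B)" using F(1) by (intro closed_vimage) auto
    then have "compact (cbox 0 1 \<inter> F -` B)" by (intro compact_Int_closed compact_cbox)
    moreover have "G -` B \<inter> K = ?E ` (cbox 0 1 \<inter> F -` B)"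
      by (auto simp: K_def GE)
    ultimately show "closed (G -` B \<inter> K)" using compact by (simp add: compact_imp_closed)
  qed
  then obtain p where p: "real_polynomial_function p" "\<And>x. x \<in> K \<Longrightarrow> \<bar>G x - p x\<bar> < e"
    using Stone_Weierstrass_real_polynomial_function[OF K _ \<open>e > 0\<close>] by blast
  show thesis
  proof
    show "trig_poly (\<lambda>v. p (?E v))" using p(1) by (rule trig_poly_polynomial_torus_embedding)
    show "\<bar>F v - p (?E v)\<bar> < e" for v using p(2)[OF E_K[of v]] by (simp add: GE)
  qed
qed

section \<open>Existence of algebraic measures\<close>

definition uniform_unit :: "real measure" where
  "uniform_unit = uniform_measure lborel {0..<1}"

lemma sets_uniform_unit [measurable_cong, simp]: "sets uniform_unit = sets borel"
  and space_uniform_unit [simp]: "space uniform_unit = UNIV"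
  by (simp_all add: uniform_unit_def)

lemma prob_space_uniform_unit: "prob_space uniform_unit"
  unfolding uniform_unit_def by (rule prob_space_uniform_measure) auto

lemma emeasure_uniform_unit: "S \<in> sets borel \<Longrightarrow> emeasure uniform_unit S = emeasure lborel ({0..<1} \<inter> S)"
  by (simp add: uniform_unit_def emeasure_uniform_measure divide_ennreal_def)

lemma emeasure_lborel_translate:
  assumes "S \<in> sets borel"
  shows "emeasure lborel ((\<lambda>x::real. x + a) -` S) = emeasure lborel S"
proof -
  have "emeasure lborel S = emeasure (distr lborel borel ((+) a)) S"
    by (simp add: lborel_distr_plus)
  also have "\<dots> = emeasure lborel ((\<lambda>x. x + a) -` S)"
    using assms by (subst emeasure_distr) (auto simp: vimage_def add.commute)
  finally show ?thesis by simp
qed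

lemma frac_borel_measurable: "(\<lambda>x::real. frac (x + a)) \<in> borel_measurable borel"
  unfolding frac_def by measurable

text \<open>Rotation of the circle is a translation on each of two pieces of the unit interval, and
  Lebesgue measure is invariant under translation.\<close>

lemma distr_uniform_unit_frac: "distr uniform_unit borel (\<lambda>x. frac (x + a)) = uniform_unit"
proof (rule measure_eqI)
  fix S assume "S \<in> sets (distr uniform_unit borel (\<lambda>x. frac (x + a)))"
  then have S [measurable]: "S \<in> sets borel" by simp
  define b where "b = frac a"
  have b: "0 \<le> b" "b < 1" by (simp_all add: b_def frac_lt_1)
  have frac: "frac (x + a) = (if x + b < 1 then x + b else x + (b - 1))" if "0 \<le> x" "x < 1" for x
    using that by (simp add: frac_add b_def frac_eq)
  \<comment> \<open>Values in \<open>{b..<1}\<close> come from the shift by \<open>b\<close>, values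
    in \<open>{0..<b}\<close> from the shift by \<open>b - 1\<close>, which has wrapped
    around.\<close>
  have pre: "{0..<1} \<inter> (\<lambda>x. frac (x + a)) -` S
      = (\<lambda>x. x + b) -` ({b..<1} \<inter> S) \<union> (\<lambda>x. x + (b - 1)) -` ({0..<b} \<inter> S)"
    using b by (auto simp: frac split: if_splits)
  have m: "(\<lambda>x. frac (x + a)) -` S \<in> sets borel"
    using measurable_sets[OF frac_borel_measurable S] by simp
  have "emeasure (distr uniform_unit borel (\<lambda>x. frac (x + a))) S
      = emeasure lborel ({0..<1} \<inter> (\<lambda>x. frac (x + a)) -` S)"
    using m by (simp add: emeasure_distr frac_borel_measurable emeasure_uniform_unit
        measurable_cong_sets[OF sets_uniform_unit refl])
  also have "\<dots> = emeasure lborel ((\<lambda>x. x + b) -` ({b..<1} \<inter> S))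
      + emeasure lborel ((\<lambda>x. x + (b - 1)) -` ({0..<b} \<inter> S))"
    unfolding pre
  proof (rule plus_emeasure[symmetric])
    show "(\<lambda>x. x + b) -` ({b..<1} \<inter> S) \<in> sets lborel"
      using measurable_sets[of "\<lambda>x. x + b" borel borel "{b..<1} \<inter> S"] by simp
    show "(\<lambda>x. x + (b - 1)) -` ({0..<b} \<inter> S) \<in> sets lborel"
      using measurable_sets[of "\<lambda>x. x + (b - 1)" borel borel "{0..<b} \<inter> S"] by simp
  qed auto
  also have "\<dots> = emeasure lborel ({b..<1} \<inter> S) + emeasure lborel ({0..<b} \<inter> S)"
    by (simp add: emeasure_lborel_translate del: vimage_Int)
  also have "\<dots> = emeasure lborel ({b..<1} \<inter> S \<union> {0..<b} \<inter> S)"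
    by (rule plus_emeasure) auto
  also have "{b..<1} \<inter> S \<union> {0..<b} \<inter> S = {0..<1} \<inter> S" using b by auto
  finally show "emeasure (distr uniform_unit borel (\<lambda>x. frac (x + a))) S = emeasure uniform_unit S"
    by (simp add: emeasure_uniform_unit)
qed simp

section \<open>The uniform measure on a cube and its rotations\<close>

definition uniform_cube :: "'i set \<Rightarrow> ('i \<Rightarrow> real) measure" where
  "uniform_cube I = PiM I (\<lambda>_. uniform_unit)"

lemma prob_space_uniform_cube: "prob_space (uniform_cube I)"
  unfolding uniform_cube_def by (rule prob_space_PiM) (rule prob_space_uniform_unit)

lemma uniform_cube_component_measurable: "i \<in> I \<Longrightarrow> (\<lambda>\<omega>. \<omega> i) \<in> borel_measurable (uniform_cube I)"
  unfolding uniform_cube_def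
  using measurable_component_singleton[of i I "\<lambda>_. uniform_unit"]
  by (simp cong: measurable_cong_sets)

text \<open>A product measure is determined by its values on boxes, and on each coordinate the map
  is a rotation preserving the uniform measure.\<close>

lemma distr_uniform_cube_frac:
  fixes a :: "'i \<Rightarrow> real"
  assumes "finite I"
  defines "F \<equiv> (\<lambda>\<omega>. \<lambda>i\<in>I. frac (\<omega> i + a i))"
  shows "F \<in> measurable (uniform_cube I) (uniform_cube I)"
    and "distr (uniform_cube I) (uniform_cube I) F = uniform_cube I"
proof -
  interpret U: prob_space uniform_unit by (rule prob_space_uniform_unit)
  interpret P: product_prob_space "\<lambda>_::'i. uniform_unit"
    by standard
  have fr: "(\<lambda>x. frac (x + a i)) \<in> measurable uniform_unit uniform_unit" for i
    using frac_borel_measurable[of "a i"] by (simp cong: measurable_cong_sets)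
  show F: "F \<in> measurable (uniform_cube I) (uniform_cube I)"
    unfolding F_def uniform_cube_def
  proof (rule measurable_restrict)
    fix i assume "i \<in> I"
    then show "(\<lambda>\<omega>. frac (\<omega> i + a i)) \<in> measurable (PiM I (\<lambda>_. uniform_unit)) uniform_unit"
      using measurable_compose[OF measurable_component_singleton[of i I "\<lambda>_. uniform_unit"] fr[of i]] by simp
  qed
  show "distr (uniform_cube I) (uniform_cube I) F = uniform_cube I"
    unfolding uniform_cube_def
  proof (rule P.PiM_eqI[OF assms(1)])
    fix A assume A: "\<And>i. i \<in> I \<Longrightarrow> A i \<in> sets uniform_unit"
    let ?N = "PiM I (\<lambda>_. uniform_unit)"
    have "emeasure (distr ?N ?N F) (PiE I A) = emeasure ?N (F -` PiE I A \<inter> space ?N)"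
      using F A assms(1) by (intro emeasure_distr sets_PiM_I_finite) (auto simp: uniform_cube_def)
    also have "F -` PiE I A \<inter> space ?N = PiE I (\<lambda>i. (\<lambda>x. frac (x + a i)) -` A i)"
      by (auto simp: F_def space_PiM PiE_def Pi_def)
    also have "emeasure ?N \<dots> = (\<Prod>i\<in>I. emeasure uniform_unit ((\<lambda>x. frac (x + a i)) -` A i))"
    proof (rule P.emeasure_PiM[OF assms(1)])
      fix i assume "i \<in> I"
      then show "(\<lambda>x. frac (x + a i)) -` A i \<in> sets uniform_unit"
        using measurable_sets[OF fr A] by simp
    qed
    also have "\<dots> = (\<Prod>i\<in>I. emeasure uniform_unit (A i))"
    proof (rule prod.cong[OF refl])
      fix i assume "i \<in> I"
      then have "emeasure uniform_unit (A i) = emeasure (distr uniform_unit borel (\<lambda>x. frac (x + a i))) (A i)"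
        by (simp add: distr_uniform_unit_frac)
      also have "\<dots> = emeasure uniform_unit ((\<lambda>x. frac (x + a i)) -` A i)"
        using A[OF \<open>i \<in> I\<close>] frac_borel_measurable[of "a i"]
        by (subst emeasure_distr) (simp_all cong: measurable_cong_sets)
      finally show "emeasure uniform_unit ((\<lambda>x. frac (x + a i)) -` A i) = emeasure uniform_unit (A i)"
        by simp
    qed
    finally show "emeasure (distr ?N ?N F) (PiE I A) = (\<Prod>i\<in>I. emeasure uniform_unit (A i))" .
  qed simp
qed

lemma compact_parallelepiped:
  fixes c :: "'i \<Rightarrow> 'a::real_normed_vector"
  shows "compact ((\<lambda>s. \<Sum>i\<in>I. s i *\<^sub>R c i) ` (UNIV \<rightarrow>\<^sub>E {0..1::real}))"
proof (rule compact_continuous_image)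
  have "continuous_on UNIV (\<lambda>s. \<Sum>i\<in>I. s i *\<^sub>R c i)"
    by (intro continuous_intros continuous_on_product_coordinates)
  then show "continuous_on (UNIV \<rightarrow>\<^sub>E {0..1::real}) (\<lambda>s. \<Sum>i\<in>I. s i *\<^sub>R c i)"
    by (rule continuous_on_subset) simp
  have "compactin (product_topology (\<lambda>i::'i. euclideanreal) UNIV) (UNIV \<rightarrow>\<^sub>E {0..1})"
    by (subst compactin_PiE) auto
  then show "compact (UNIV \<rightarrow>\<^sub>E {0..1::real} :: ('i \<Rightarrow> real) set)"
    by (simp add: euclidean_product_topology)
qed

section \<open>Invariant measures on cosets in a fibre\<close>

lemma closed_lattice_of:
  fixes g :: "real^'d^'d"
  assumes "det g \<noteq> 0"
  shows "closed (lattice_of g)"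
proof -
  have "lattice_of g = (\<lambda>v. matrix_inv g *v v) -` integer_vectors"
    using assms by (force simp: lattice_of_def matrix_inv_mult_vec image_iff)
  then show ?thesis
    by (simp add: closed_vimage closed_integer_vectors continuous_on_matrix_vector_mult)
qed

lemma continuous_map_grid_of_fixed_lattice:
  assumes "det g = 1"
  shows "continuous_map euclidean grid_space (\<lambda>v. (+) v ` lattice_of g)"
proof -
  have "continuous_map euclidean ASL_top (\<lambda>v. (g, v))"
    using assms by (auto simp: ASL_top_def continuous_map_in_subtopology intro!: continuous_intros)
  moreover have "continuous_map ASL_top grid_space grid_of"
    unfolding grid_space_def by (intro quotient_imp_continuous_map quotient_map_quotient_top)
  ultimately have "continuous_map euclidean grid_space (grid_of \<circ> (\<lambda>v. (g, v)))"
    by (rule continuous_map_compose)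
  then show ?thesis by (simp add: grid_of_def o_def)
qed

lemma sum_integer_combination:
  "finite C \<Longrightarrow> C \<subseteq> integer_vectors \<Longrightarrow> (\<And>b. b \<in> C \<Longrightarrow> n b \<in> \<int>) \<Longrightarrow> (\<Sum>b\<in>C. n b *\<^sub>R b) \<in> integer_vectors"
  by (auto simp: integer_vectors_def subset_iff intro!: Ints_sum Ints_mult)

text \<open>Coefficients in the cube over \<open>C\<close> are sent to the corresponding grids.
  Since \<open>C\<close> is integral, coefficients matter only modulo 1, so translation along the
  subspace becomes a rotation of the cube, which preserves the uniform measure.\<close>

lemma exists_coset_measure:
  fixes g :: "real^'d^'d" and w :: "real^'d"
  assumes g: "det g = 1" and C: "C \<subseteq> integer_vectors" "finite C"
  obtains \<nu> where "prob_space \<nu>" "sets \<nu> = sets (borel_sigma grid_space)"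
    "emeasure \<nu> ((\<lambda>u. (+) u ` ((+) (g *v w) ` lattice_of g)) ` ((*v) g ` span C)) = 1"
    "\<forall>u \<in> (*v) g ` span C. distr \<nu> (borel_sigma grid_space) ((`) ((+) u)) = \<nu>"
proof -
  let ?L = "lattice_of g" and ?Y = "borel_sigma grid_space" and ?N = "uniform_cube C"
  define comb where "comb s = (\<Sum>b\<in>C. s b *\<^sub>R b)" for s :: "real^'d \<Rightarrow> real"
  define grid where "grid v = (+) v ` ?L" for v
  define \<Phi> where "\<Phi> \<omega> = grid (g *v (w + comb \<omega>))" for \<omega>
  define coset where "coset = (\<lambda>u. (+) u ` ((+) (g *v w) ` ?L)) ` ((*v) g ` span C)"
  interpret N: prob_space ?N by (rule prob_space_uniform_cube)
  have span: "span C = range comb"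
    using span_finite[OF C(2)] by (simp add: comb_def[abs_def])
  have translate: "(+) u ` grid v = grid (u + v)" for u v
    by (simp add: grid_def image_image add.assoc)
  have grid_eq: "grid (g *v (v + p)) = grid (g *v v)" if "p \<in> integer_vectors" for v p
    unfolding grid_def matrix_vector_right_distrib by (rule translate_eq_lattice_of[OF lattice_ofI[OF that]])
  have comb_frac: "grid (g *v (w + comb (\<lambda>b. frac (s b)))) = grid (g *v (w + comb s))" for s
  proof -
    have "comb s = comb (\<lambda>b. frac (s b)) + (\<Sum>b\<in>C. of_int \<lfloor>s b\<rfloor> *\<^sub>R b)"
      by (simp add: comb_def frac_def sum.distrib[symmetric] scaleR_left_distrib[symmetric])
    then have eq: "w + comb s = (w + comb (\<lambda>b. frac (s b))) + (\<Sum>b\<in>C. of_int \<lfloor>s b\<rfloor> *\<^sub>R b)" by simp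
    have "(\<Sum>b\<in>C. of_int \<lfloor>s b\<rfloor> *\<^sub>R b) \<in> (integer_vectors :: (real^'d) set)"
      by (rule sum_integer_combination[OF C(2,1)]) simp
    then show ?thesis unfolding eq by (rule grid_eq[symmetric])
  qed
  have coset: "coset = range (\<lambda>s. grid (g *v (w + comb s)))"
    unfolding coset_def span image_image grid_def[symmetric] translate
    by (simp add: matrix_vector_right_distrib add.commute)
  have comb_meas: "comb \<in> borel_measurable ?N"
    unfolding comb_def by (intro borel_measurable_sum borel_measurable_scaleR
        uniform_cube_component_measurable borel_measurable_const)
  have "(\<lambda>v. grid (g *v (w + v))) \<in> measurable borel ?Y"
  proof -
    have "continuous_map euclidean euclidean (\<lambda>v. g *v (w + v))"
      by (auto intro!: continuous_intros continuous_on_matrix_vector_mult)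
    from continuous_map_compose[OF this continuous_map_grid_of_fixed_lattice[OF g]]
    have "continuous_map euclidean grid_space (\<lambda>v. grid (g *v (w + v)))"
      by (simp add: o_def grid_def)
    from measurable_borel_sigma[OF this] show ?thesis by (simp add: borel_sigma_euclidean)
  qed
  from measurable_compose[OF comb_meas this] have \<Phi>: "\<Phi> \<in> measurable ?N ?Y"
    by (simp add: \<Phi>_def[abs_def])
  define \<nu> where "\<nu> = distr ?N ?Y \<Phi>"
  \<comment> \<open>The support must be Borel. It is the image of \<open>D\<close>, the sum of a
    compact parallelepiped and the closed lattice; reducing coefficients modulo 1 shows that this
    image is the entire coset.\<close>
  have coset_sets: "coset \<in> sets ?Y"
  proof -
    define K where "K = (\<lambda>v. g *v (w + v)) ` (comb ` (UNIV \<rightarrow>\<^sub>E {0..1}))"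
    have "compact K" unfolding K_def comb_def[abs_def]
      by (intro compact_continuous_image compact_parallelepiped continuous_on_matrix_vector_mult continuous_intros)
    define D where "D = (\<Union>x\<in>K. \<Union>y\<in>?L. {x + y})"
    have D_per: "v + p \<in> D" if v: "v \<in> D" and p: "p \<in> ?L" for v p
    proof -
      from v obtain x y where "x \<in> K" "y \<in> ?L" "v = x + y" unfolding D_def by blast
      then have "v + p = x + (y + p)" "x \<in> K" "y + p \<in> ?L"
        using p by (auto simp: add.assoc lattice_of_add)
      then show ?thesis unfolding D_def by blast
    qed
    have "closed D"
      unfolding D_def using \<open>compact K\<close> closed_lattice_of[of g] g by (intro compact_closed_sums) auto
    then have "closedin grid_space (grid ` D)"
      using closedin_torus_image[OF g _ D_per] by (simp add: grid_def[abs_def])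
    moreover have "grid ` D = coset"
    proof
      show "grid ` D \<subseteq> coset"
      proof clarify
        fix v assume "v \<in> D"
        then obtain s y where "y \<in> ?L" "v = g *v (w + comb s) + y" by (auto simp: D_def K_def)
        then have "grid v = grid (g *v (w + comb s))"
          by (simp add: grid_def translate_eq_lattice_of)
        then show "grid v \<in> coset" by (auto simp: coset)
      qed
      show "coset \<subseteq> grid ` D"
        unfolding coset
      proof clarify
        fix s :: "real^'d \<Rightarrow> real"
        have "(\<lambda>b. frac (s b)) \<in> UNIV \<rightarrow>\<^sub>E {0..1}"
          by (auto simp: less_imp_le frac_lt_1)
        then have "g *v (w + comb (\<lambda>b. frac (s b))) \<in> K" by (auto simp: K_def)
        then have "g *v (w + comb (\<lambda>b. frac (s b))) + 0 \<in> D" unfolding D_def by (blast intro: zero_in_lattice_of)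
        then show "grid (g *v (w + comb s)) \<in> grid ` D"
          using comb_frac[of s] by (metis add.right_neutral imageI)
      qed
    qed
    ultimately show ?thesis using sets_borel_sigma_closedin by metis
  qed
  show thesis
  proof
    show "prob_space \<nu>" unfolding \<nu>_def by (rule N.prob_space_distr[OF \<Phi>])
    show "sets \<nu> = sets ?Y" by (simp add: \<nu>_def)
    have "\<Phi> -` coset \<inter> space ?N = space ?N" by (auto simp: \<Phi>_def coset)
    then have "emeasure \<nu> coset = 1"
      using N.emeasure_space_1 by (simp add: \<nu>_def emeasure_distr[OF \<Phi> coset_sets])
    then show "emeasure \<nu> ((\<lambda>u. (+) u ` ((+) (g *v w) ` ?L)) ` ((*v) g ` span C)) = 1"
      by (simp add: coset_def)
    show "\<forall>u \<in> (*v) g ` span C. distr \<nu> ?Y ((`) ((+) u)) = \<nu>"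
    proof
      fix u assume "u \<in> (*v) g ` span C"
      then obtain a where u: "u = g *v comb a" by (auto simp: span)
      define F where "F = (\<lambda>\<omega>. \<lambda>b\<in>C. frac (\<omega> b + a b))"
      have F: "F \<in> measurable ?N ?N" "distr ?N ?N F = ?N"
        unfolding F_def by (rule distr_uniform_cube_frac[OF C(2)])+
      have "(+) u ` \<Phi> \<omega> = \<Phi> (F \<omega>)" for \<omega>
      proof -
        have "\<Phi> (F \<omega>) = grid (g *v (w + comb (\<lambda>b. frac (\<omega> b + a b))))"
          by (simp add: \<Phi>_def F_def comb_def)
        also have "\<dots> = grid (g *v (w + comb (\<lambda>b. \<omega> b + a b)))" by (rule comb_frac)
        also have "w + comb (\<lambda>b. \<omega> b + a b) = comb a + (w + comb \<omega>)"
          by (simp add: comb_def scaleR_left_distrib sum.distrib)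
        finally show ?thesis by (simp add: \<Phi>_def translate u matrix_vector_right_distrib)
      qed
      then have "(`) ((+) u) \<circ> \<Phi> = \<Phi> \<circ> F" by (simp add: fun_eq_iff)
      moreover have "(`) ((+) u) \<in> measurable ?Y ?Y"
        by (rule measurable_borel_sigma[OF continuous_map_translation_grid_space])
      then have "distr \<nu> ?Y ((`) ((+) u)) = distr ?N ?Y ((`) ((+) u) \<circ> \<Phi>)"
        unfolding \<nu>_def using \<Phi> by (intro distr_distr)
      moreover have "distr ?N ?Y (\<Phi> \<circ> F) = distr (distr ?N ?N F) ?Y \<Phi>"
        using \<Phi> F(1) by (intro distr_distr[symmetric])
      ultimately show "distr \<nu> ?Y ((`) ((+) u)) = \<nu>" by (simp add: F(2) \<nu>_def)
    qed
  qed
qed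

section \<open>Convergence of algebraic measures\<close>

text \<open>The quotient map onto the space of lattices is open: the preimage of the image of an
  open set is a union of open right translates. Lattices near the limit therefore have a basis near
  \<open>g\<close>.\<close>

lemma eventually_lattice_lift:
  fixes g :: "real^'d^'d"
  assumes g: "det g = 1" and lim: "limitin lattice_space X (lattice_of g) F" and "e > 0"
  shows "\<forall>\<^sub>F k in F. \<exists>h. det h = 1 \<and> dist h g < e \<and> X k = lattice_of h"
proof -
  define W where "W = {h :: real^'d^'d. det h = 1} \<inter> ball g e"
  \<comment> \<open>The stabiliser of the integer lattice, that is, the group
    \<open>SL_d(Z)\<close>, whose right translates give the fibres of
    \<open>lattice_of\<close>.\<close>
  define \<Gamma> where "\<Gamma> = {\<gamma> :: real^'d^'d. det \<gamma> = 1 \<and> lattice_of \<gamma> = integer_vectors}"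
  have pre: "{h \<in> topspace SL_top. lattice_of h \<in> lattice_of ` W}
      = {h. det h = 1} \<inter> (\<Union>\<gamma>\<in>\<Gamma>. (\<lambda>h. h ** \<gamma>) -` ball g e)"
  proof (intro equalityI subsetI)
    fix h :: "real^'d^'d" assume "h \<in> {h \<in> topspace SL_top. lattice_of h \<in> lattice_of ` W}"
    then obtain q where h: "det h = 1" and q: "det q = 1" "q \<in> ball g e" "lattice_of h = lattice_of q"
      by (auto simp: SL_top_def W_def)
    define \<gamma> where "\<gamma> = matrix_inv h ** q"
    have "lattice_of \<gamma> = (*v) (matrix_inv h) ` lattice_of h"
      by (simp add: \<gamma>_def lattice_of_mult q(3))
    also have "\<dots> = integer_vectors"
      using h by (simp add: lattice_of_def image_image matrix_inv_mult_vec)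
    finally have "\<gamma> \<in> \<Gamma>" using h q(1) by (simp add: \<Gamma>_def \<gamma>_def det_mul det_matrix_inv)
    moreover have "h ** \<gamma> = q" using h by (simp add: \<gamma>_def matrix_inv_mult_mat)
    ultimately show "h \<in> {h. det h = 1} \<inter> (\<Union>\<gamma>\<in>\<Gamma>. (\<lambda>h. h ** \<gamma>) -` ball g e)"
      using h q(2) by auto
  next
    fix h :: "real^'d^'d" assume "h \<in> {h. det h = 1} \<inter> (\<Union>\<gamma>\<in>\<Gamma>. (\<lambda>h. h ** \<gamma>) -` ball g e)"
    then obtain \<gamma> where h: "det h = 1" and \<gamma>: "\<gamma> \<in> \<Gamma>" "h ** \<gamma> \<in> ball g e" by auto
    have "h ** \<gamma> \<in> W" using h \<gamma> by (simp add: W_def \<Gamma>_def det_mul)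
    moreover have "lattice_of (h ** \<gamma>) = lattice_of h"
      using \<gamma>(1) unfolding lattice_of_mult by (simp add: \<Gamma>_def lattice_of_def[of h])
    ultimately show "h \<in> {h \<in> topspace SL_top. lattice_of h \<in> lattice_of ` W}"
      using h unfolding SL_top_def by (auto intro: image_eqI[where x = "h ** \<gamma>"])
  qed
  have "open ((\<lambda>h. h ** \<gamma>) -` ball g e)" for \<gamma> :: "real^'d^'d"
    by (rule open_vimage) (auto simp: matrix_matrix_mult_def intro!: continuous_intros)
  then have "open (\<Union>\<gamma>\<in>\<Gamma>. (\<lambda>h. h ** \<gamma>) -` ball g e)" by blast
  then have "openin SL_top {h \<in> topspace SL_top. lattice_of h \<in> lattice_of ` W}"
    unfolding pre unfolding SL_top_def by (rule openin_open_Int)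
  then have "openin lattice_space (lattice_of ` W)"
    by (auto simp: lattice_space_def openin_quotient_top W_def SL_top_def)
  moreover have "lattice_of g \<in> lattice_of ` W" using g \<open>e > 0\<close> by (simp add: W_def)
  ultimately have "\<forall>\<^sub>F k in F. X k \<in> lattice_of ` W"
    using lim by (auto simp: limitin_def)
  then show ?thesis
    by eventually_elim (auto simp: W_def dist_commute)
qed

section \<open>Test functions on neighbouring fibres\<close>

lemma continuous_on_grid_of:
  assumes "continuous_map grid_space euclideanreal f"
  shows "continuous_on ({g. det g = 1} \<times> UNIV) (\<lambda>p. f (grid_of p))"
proof -
  have "continuous_map ASL_top grid_space grid_of"
    unfolding grid_space_def by (intro quotient_imp_continuous_map quotient_map_quotient_top)
  from continuous_map_compose[OF this assms] show ?thesis
    by (simp add: ASL_top_def o_def)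
qed

text \<open>Since \<open>v\<close> matters only modulo integer vectors, all the fibres are
  parametrised by a compact set: the sequence with its limit, times the unit cube. The function
  pulled back to that set is uniformly continuous.\<close>

lemma eventually_uniformly_close_on_fibres:
  fixes G :: "nat \<Rightarrow> real^'d^'d"
  assumes f: "continuous_map grid_space euclideanreal f"
    and G: "G \<longlonglongrightarrow> g" "\<And>l. det (G l) = 1" "det g = 1" and "e > 0"
  shows "\<forall>\<^sub>F l in sequentially. \<forall>v.
    \<bar>f ((+) (G l *v v) ` lattice_of (G l)) - f ((+) (g *v v) ` lattice_of g)\<bar> < e"
proof -
  define \<Psi> where "\<Psi> p = f (grid_of (fst p, fst p *v snd p))" for p :: "(real^'d^'d) \<times> (real^'d)"
  define K where "K = insert g (range G) \<times> cbox (0 :: real^'d) 1"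
  have "compact K"
    unfolding K_def using G(1) by (intro compact_Times compact_cbox compact_sequence_with_limit)
  have "continuous_on K ((\<lambda>p. f (grid_of p)) \<circ> (\<lambda>p. (fst p, fst p *v snd p)))"
  proof (rule continuous_on_compose)
    show "continuous_on K (\<lambda>p. (fst p, fst p *v snd p))"
      by (intro continuous_intros continuous_on_matrix_vector_mult)
    show "continuous_on ((\<lambda>p. (fst p, fst p *v snd p)) ` K) (\<lambda>p. f (grid_of p))"
      by (rule continuous_on_subset[OF continuous_on_grid_of[OF f]]) (use G in \<open>auto simp: K_def\<close>)
  qed
  then have "continuous_on K \<Psi>" by (simp add: \<Psi>_def[abs_def] o_def)
  then have "uniformly_continuous_on K \<Psi>" using \<open>compact K\<close> by (rule compact_uniformly_continuous)
  then obtain d where d: "d > 0" "\<And>p q. p \<in> K \<Longrightarrow> q \<in> K \<Longrightarrow> dist q p < d \<Longrightarrow> dist (\<Psi> q) (\<Psi> p) < e"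
    unfolding uniformly_continuous_on_def using \<open>e > 0\<close> by metis
  from G(1) d(1) have "\<forall>\<^sub>F l in sequentially. dist (G l) g < d" by (rule tendstoD)
  then show ?thesis
  proof eventually_elim
    case (elim l)
    show ?case
    proof
      fix v :: "real^'d"
      obtain p where p: "p \<in> integer_vectors" "v - p \<in> cbox 0 1" by (rule exists_cube_representative)
      have red: "f ((+) (h *v v) ` lattice_of h) = \<Psi> (h, v - p)" for h
      proof -
        have "(+) (h *v v) ` lattice_of h = (+) (h *v (v - p) + h *v p) ` lattice_of h"
          by (simp add: matrix_vector_right_distrib[symmetric])
        also have "\<dots> = (+) (h *v (v - p)) ` lattice_of h"
          by (rule translate_eq_lattice_of[OF lattice_ofI[OF p(1)]])
        finally show ?thesis by (simp add: \<Psi>_def grid_of_def)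
      qed
      have "dist (G l, v - p) (g, v - p) < d" using elim by (simp add: dist_Pair_Pair)
      then have "dist (\<Psi> (G l, v - p)) (\<Psi> (g, v - p)) < e"
        using p(2) by (intro d(2)) (auto simp: K_def)
      then show "\<bar>f ((+) (G l *v v) ` lattice_of (G l)) - f ((+) (g *v v) ` lattice_of g)\<bar> < e"
        by (simp add: red dist_real_def)
    qed
  qed
qed

lemma vanishing_at_infinity_bounded:
  assumes "f \<in> vanishing_at_infinity T"
  obtains b where "\<And>y. y \<in> topspace T \<Longrightarrow> \<bar>f y\<bar> \<le> b"
proof -
  from assms have f: "continuous_map T euclideanreal f"
    and "\<exists>K. compactin T K \<and> (\<forall>y \<in> topspace T - K. \<bar>f y\<bar> < 1)"
    by (auto simp: vanishing_at_infinity_def)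
  then obtain K where K: "compactin T K" "\<forall>y \<in> topspace T - K. \<bar>f y\<bar> < 1" by blast
  have "compact (f ` K)"
    using image_compactin[OF K(1) f] by simp
  then obtain b where b: "\<forall>x\<in>f ` K. \<bar>x\<bar> \<le> b"
    using compact_imp_bounded bounded_real by metis
  show thesis
  proof
    fix y assume "y \<in> topspace T"
    then show "\<bar>f y\<bar> \<le> max b 1" using K(2) b by (cases "y \<in> K") force+
  qed
qed

lemma borel_measurable_continuous_map:
  assumes "continuous_map T euclideanreal f"
  shows "f \<in> borel_measurable (borel_sigma T)"
  using measurable_borel_sigma[OF assms] by (simp add: borel_sigma_euclidean)

lemma trig_poly_continuous: "trig_poly p \<Longrightarrow> continuous_on UNIV p"
  by (induction rule: trig_poly.induct) (auto intro!: continuous_intros)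

lemma trig_poly_periodic: "trig_poly p \<Longrightarrow> n \<in> integer_vectors \<Longrightarrow> p (v + n) = p v"
proof (induction rule: trig_poly.induct)
  case (wave \<xi> c)
  then show ?case
    using cos_add_Ints[OF inner_integer_vectors, of \<xi> n "2 * pi * (\<xi> \<bullet> v) + c"]
    by (simp add: inner_right_distrib algebra_simps)
qed auto

lemma trig_poly_bounded: "trig_poly p \<Longrightarrow> \<exists>b. \<forall>v. \<bar>p v\<bar> \<le> b"
proof (induction rule: trig_poly.induct)
  case (wave \<xi> c)
  show ?case by (rule exI[of _ 1]) simp
next
  case (add p q)
  then obtain a b where "\<forall>v. \<bar>p v\<bar> \<le> a" "\<forall>v. \<bar>q v\<bar> \<le> b" by blast
  then have "\<forall>v. \<bar>p v + q v\<bar> \<le> a + b" by (meson abs_triangle_ineq add_mono order_trans)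
  then show ?case by blast
next
  case (scale p a)
  then obtain b where "\<forall>v. \<bar>p v\<bar> \<le> b" by blast
  then have "\<forall>v. \<bar>a * p v\<bar> \<le> \<bar>a\<bar> * b" by (simp add: abs_mult mult_left_mono)
  then show ?case by blast
qed

lemma (in prob_space) expectation_diff_le:
  fixes a b :: "'a \<Rightarrow> real"
  assumes "integrable M a" "integrable M b" "AE z in M. \<bar>a z - b z\<bar> \<le> e"
  shows "\<bar>expectation a - expectation b\<bar> \<le> e"
proof -
  have "\<bar>expectation (\<lambda>z. a z - b z)\<bar> \<le> expectation (\<lambda>z. \<bar>a z - b z\<bar>)"
    by (rule integral_abs_bound)
  also have "\<dots> \<le> e"
    using assms by (intro integral_le_const) auto
  finally show ?thesis using assms by simp
qed

section \<open>Weak* convergence from Fourier coefficients\<close>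

lemma continuous_on_matrix_vector_mult_right: "continuous_on S (\<lambda>v. A *v v)" for A :: "real^'n^'m"
  by (intro continuous_on_matrix_vector_mult continuous_intros)

lemma integrable_torus_trig_poly:
  assumes "trig_poly p" "det g = 1" "prob_space \<mu>" "sets \<mu> = sets (borel_sigma grid_space)"
    and "\<And>q. q \<in> lattice_of g \<Longrightarrow> A *v q \<in> integer_vectors"
  shows "integrable \<mu> (torus_fun (lattice_of g) (\<lambda>v. p (A *v v)))"
proof -
  obtain b where "\<And>v. \<bar>p v\<bar> \<le> b" using trig_poly_bounded[OF assms(1)] by blast
  moreover have "continuous_on UNIV (\<lambda>v. p (A *v v))"
    by (rule continuous_on_compose2[OF trig_poly_continuous[OF assms(1)] continuous_on_matrix_vector_mult_right]) simp
  moreover have "p (A *v (v + q)) = p (A *v v)" if "q \<in> lattice_of g" for v q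
    using assms(5)[OF that] by (simp add: matrix_vector_right_distrib trig_poly_periodic[OF assms(1)])
  ultimately show ?thesis by (intro integrable_torus_fun[OF assms(2-4)]) auto
qed

text \<open>The inverses of \<open>G l\<close> and \<open>g\<close> carry all fibres to the standard
  torus, where \<open>waves\<close> is convergence of Fourier coefficients. It extends linearly to
  trigonometric polynomials, which approximate a test function uniformly on the limit fibre and, by
  closeness of the fibres, on the moving ones.\<close>

lemma weak_star_limit_coset_measures:
  fixes g\<^sub>0 g :: "real^'d^'d" and G H :: "nat \<Rightarrow> real^'d^'d" and v\<^sub>0 w :: "real^'d"
  assumes g\<^sub>0: "det g\<^sub>0 = 1" and G: "G \<longlonglongrightarrow> g" "\<And>l. det (G l) = 1" "det g = 1"
    and H: "\<And>l. det (H l) = 1" "\<And>l. (*v) (H l) ` lattice_of g\<^sub>0 = lattice_of (G l)"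
    and \<mu>: "prob_space \<mu>" "sets \<mu> = sets (borel_sigma grid_space)" "subspace U"
      "emeasure \<mu> ((\<lambda>u. (+) u ` ((+) v\<^sub>0 ` lattice_of g\<^sub>0)) ` U) = 1"
      "\<And>u. u \<in> U \<Longrightarrow> distr \<mu> (borel_sigma grid_space) ((`) ((+) u)) = \<mu>"
    and \<nu>: "prob_space \<nu>" "sets \<nu> = sets (borel_sigma grid_space)" "subspace V"
      "emeasure \<nu> ((\<lambda>u. (+) u ` ((+) (g *v w) ` lattice_of g)) ` V) = 1"
      "\<And>u. u \<in> V \<Longrightarrow> distr \<nu> (borel_sigma grid_space) ((`) ((+) u)) = \<nu>"
    and waves: "\<And>\<xi> c. \<xi> \<in> integer_vectors \<Longrightarrow>
      (\<lambda>l. if \<forall>u\<in>U. \<xi> \<bullet> ((matrix_inv (G l) ** H l) *v u) = 0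
        then cos (2 * pi * (\<xi> \<bullet> ((matrix_inv (G l) ** H l) *v v\<^sub>0)) + c) else 0)
      \<longlonglongrightarrow> (if \<forall>u\<in>V. \<xi> \<bullet> (matrix_inv g *v u) = 0 then cos (2 * pi * (\<xi> \<bullet> w) + c) else 0)"
  shows "limitin (weak_star_topology grid_space)
      (\<lambda>l. distr \<mu> (borel_sigma grid_space) ((`) ((*v) (H l)))) \<nu> sequentially"
proof -
  let ?Y = "borel_sigma (grid_space :: (real^'d) set topology)"
  define A where "A l = matrix_inv (G l) ** H l" for l
  interpret M: prob_space \<mu> by (rule \<mu>)
  interpret N: prob_space \<nu> by (rule \<nu>)
  have nz: "det (G l) \<noteq> 0" "det g \<noteq> 0" for l using G by auto
  have A_int: "A l *v q \<in> integer_vectors" if q: "q \<in> lattice_of g\<^sub>0" for l q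
  proof -
    have "H l *v q \<in> lattice_of (G l)" using q H(2)[of l] by blast
    then obtain p where "p \<in> integer_vectors" "H l *v q = G l *v p" by (auto simp: lattice_of_def)
    then show ?thesis
      using nz by (simp add: A_def matrix_vector_mul_assoc[symmetric] matrix_inv_mult_vec)
  qed
  have g_int: "matrix_inv g *v q \<in> integer_vectors" if "q \<in> lattice_of g" for q
    using that nz by (auto simp: lattice_of_def matrix_inv_mult_vec)
  \<comment> \<open>\<open>I p l\<close> and \<open>I' p\<close> are the integrals of
    \<open>p\<close> against the pushed measure and the limit measure, both read on the standard
    torus.\<close>
  define I where "I p l = (\<integral>z. torus_fun (lattice_of g\<^sub>0) (\<lambda>v. p (A l *v v)) z \<partial>\<mu>)" for p l
  define I' where "I' p = (\<integral>z. torus_fun (lattice_of g) (\<lambda>v. p (matrix_inv g *v v)) z \<partial>\<nu>)" for p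
  have int: "integrable \<mu> (torus_fun (lattice_of g\<^sub>0) (\<lambda>v. p (A l *v v)))" if "trig_poly p" for p l
    by (rule integrable_torus_trig_poly[OF that g\<^sub>0 \<mu>(1,2) A_int])
  have int': "integrable \<nu> (torus_fun (lattice_of g) (\<lambda>v. p (matrix_inv g *v v)))" if "trig_poly p" for p
    by (rule integrable_torus_trig_poly[OF that G(3) \<nu>(1,2) g_int])
  have torus_fun_add: "torus_fun x (\<lambda>v. a v + b v) = (\<lambda>z. torus_fun x a z + torus_fun x b z)"
    and torus_fun_scale: "torus_fun x (\<lambda>v. r * a v) = (\<lambda>z. r * torus_fun x a z)"
    for x and a b :: "real^'d \<Rightarrow> real" and r
    by (simp_all add: torus_fun_def fun_eq_iff)
  have I_lim: "I p \<longlonglongrightarrow> I' p" if "trig_poly p" for p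
    using that
  proof induction
    case (wave \<xi> c)
    \<comment> \<open>Moving the matrix to the frequency gives the wave the shape required by
      \<open>integral_wave\<close>, with a frequency pairing integrally with the lattice of the
      fibre.\<close>
    have *: "\<xi> \<bullet> (B *v v) = (\<xi> v* B) \<bullet> v" for B and v :: "real^'d"
      by (simp add: dot_lmul_matrix)
    have I_wave: "I (\<lambda>v. cos (2 * pi * (\<xi> \<bullet> v) + c)) = (\<lambda>l.
        if \<forall>u\<in>U. \<xi> \<bullet> (A l *v u) = 0 then cos (2 * pi * (\<xi> \<bullet> (A l *v v\<^sub>0)) + c) else 0)"
      unfolding I_def *
      by (rule ext, rule integral_wave[OF g\<^sub>0 \<mu>]) (use A_int inner_integer_vectors[OF wave] in \<open>auto simp flip: *\<close>)
    have I'_wave: "I' (\<lambda>v. cos (2 * pi * (\<xi> \<bullet> v) + c)) =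
        (if \<forall>u\<in>V. \<xi> \<bullet> (matrix_inv g *v u) = 0 then cos (2 * pi * (\<xi> \<bullet> (matrix_inv g *v (g *v w))) + c) else 0)"
      unfolding I'_def *
      by (rule integral_wave[OF G(3) \<nu>]) (use g_int inner_integer_vectors[OF wave] in \<open>auto simp flip: *\<close>)
    show ?case
      unfolding I_wave I'_wave matrix_inv_mult_vec(2)[OF nz(2)] by (rule waves[OF wave, folded A_def])
  next
    case (add p q)
    have "I (\<lambda>v. p v + q v) = (\<lambda>l. I p l + I q l)"
      using int[OF add.hyps(1)] int[OF add.hyps(2)] by (simp add: I_def torus_fun_add fun_eq_iff)
    moreover have "I' (\<lambda>v. p v + q v) = I' p + I' q"
      using int'[OF add.hyps(1)] int'[OF add.hyps(2)] by (simp add: I'_def torus_fun_add)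
    ultimately show ?case using add.IH by (simp add: tendsto_add)
  next
    case (scale p a)
    have "I (\<lambda>v. a * p v) = (\<lambda>l. a * I p l)" by (simp add: I_def torus_fun_scale fun_eq_iff)
    moreover have "I' (\<lambda>v. a * p v) = a * I' p" by (simp add: I'_def torus_fun_scale)
    ultimately show ?case using scale.IH by (simp add: tendsto_mult_left)
  qed
  have H_meas: "(`) ((*v) (H l)) \<in> measurable \<mu> ?Y" for l
    using measurable_borel_sigma[OF continuous_map_SL_grid_space[OF H(1)], of l]
      measurable_cong_sets[OF \<mu>(2) refl] by blast
  have AE_\<mu>: "AE z in \<mu>. \<exists>v. z = (+) v ` lattice_of g\<^sub>0"
    using AE_in_if_emeasure_eq_1[OF \<mu>(1,4)] by eventually_elim (auto simp: image_image add.assoc[symmetric])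
  have AE_\<nu>: "AE z in \<nu>. \<exists>v. z = (+) v ` lattice_of g"
    using AE_in_if_emeasure_eq_1[OF \<nu>(1,4)] by eventually_elim (auto simp: image_image add.assoc[symmetric])
  have H_grid: "(*v) (H l) ` (+) v ` lattice_of g\<^sub>0 = (+) (G l *v (A l *v v)) ` lattice_of (G l)" for l v
  proof -
    have "(*v) (H l) ` (+) v ` lattice_of g\<^sub>0 = (+) (H l *v v) ` ((*v) (H l) ` lattice_of g\<^sub>0)"
      by (simp add: image_image matrix_vector_right_distrib)
    also have "H l *v v = G l *v (A l *v v)"
      using nz by (simp add: A_def matrix_vector_mul_assoc[symmetric] matrix_inv_mult_vec)
    finally show ?thesis by (simp add: H(2))
  qed
  show ?thesis
    unfolding limitin_weak_star_topology
  proof (intro conjI ballI)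
    show "\<nu> \<in> finite_borel_measures grid_space"
      using \<nu>(2) N.finite_measure_axioms by (simp add: finite_borel_measures_def)
    show "\<forall>\<^sub>F l in sequentially. distr \<mu> ?Y ((`) ((*v) (H l))) \<in> finite_borel_measures grid_space"
      using M.finite_measure_distr[OF H_meas] by (simp add: finite_borel_measures_def)
    fix f :: "(real^'d) set \<Rightarrow> real" assume f_van: "f \<in> vanishing_at_infinity grid_space"
    then have f: "continuous_map grid_space euclideanreal f" by (simp add: vanishing_at_infinity_def)
    obtain b where b: "\<And>y. y \<in> topspace grid_space \<Longrightarrow> \<bar>f y\<bar> \<le> b"
      using vanishing_at_infinity_bounded[OF f_van] by blast
    have f_meas: "f \<in> borel_measurable ?Y" by (rule borel_measurable_continuous_map[OF f])
    have f_H: "integrable \<mu> (\<lambda>z. f ((*v) (H l) ` z))" for l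
    proof (rule M.integrable_const_bound)
      show "AE z in \<mu>. norm (f ((*v) (H l) ` z)) \<le> b"
      proof (rule AE_I2)
        fix z assume "z \<in> space \<mu>"
        then have "(*v) (H l) ` z \<in> topspace grid_space" using measurable_space[OF H_meas] by simp
        then show "norm (f ((*v) (H l) ` z)) \<le> b" using b by simp
      qed
      show "(\<lambda>z. f ((*v) (H l) ` z)) \<in> borel_measurable \<mu>" by (rule measurable_compose[OF H_meas f_meas])
    qed
    have f_\<nu>: "integrable \<nu> f"
    proof (rule N.integrable_const_bound)
      show "AE z in \<nu>. norm (f z) \<le> b"
        using b sets_eq_imp_space_eq[OF \<nu>(2)] by (intro AE_I2) simp
      show "f \<in> borel_measurable \<nu>" using f_meas measurable_cong_sets[OF \<nu>(2) refl] by blast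
    qed
    have F_cont: "continuous_on UNIV (\<lambda>v. f ((+) (g *v v) ` lattice_of g))"
    proof -
      have "continuous_map euclidean euclidean ((*v) g)"
        by (simp add: continuous_on_matrix_vector_mult_right)
      from continuous_map_compose[OF continuous_map_compose[OF this continuous_map_grid_of_fixed_lattice[OF G(3)]] f]
      show ?thesis by (simp add: o_def)
    qed
    have F_per: "f ((+) (g *v (v + p)) ` lattice_of g) = f ((+) (g *v v) ` lattice_of g)"
      if "p \<in> integer_vectors" for v p
      using translate_eq_lattice_of[OF lattice_ofI[OF that]] by (simp add: matrix_vector_right_distrib)
    show "(\<lambda>l. integral\<^sup>L (distr \<mu> ?Y ((`) ((*v) (H l)))) f) \<longlonglongrightarrow> integral\<^sup>L \<nu> f"
    proof (rule tendstoI)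
      fix r :: real assume "r > 0"
      \<comment> \<open>The four shares are: one for replacing the test function by \<open>P\<close>
        on the limit fibre, one for \<open>I P l\<close> against \<open>I' P\<close>, and two on the
        moving fibre, for comparison with the limit fibre and for \<open>P\<close>.\<close>
      define e where "e = r / 4"
      have "e > 0" using \<open>r > 0\<close> by (simp add: e_def)
      obtain P where P: "trig_poly P" "\<And>v. \<bar>f ((+) (g *v v) ` lattice_of g) - P v\<bar> < e"
        using trig_poly_dense[OF F_cont F_per \<open>e > 0\<close>] by blast
      have P_tor: "torus_fun (lattice_of g\<^sub>0) (\<lambda>v. P (A l *v v)) ((+) v ` lattice_of g\<^sub>0) = P (A l *v v)" for l v
        by (rule torus_fun_translate[OF g\<^sub>0])
          (simp add: matrix_vector_right_distrib trig_poly_periodic[OF P(1) A_int])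
      have P_tor': "torus_fun (lattice_of g) (\<lambda>v. P (matrix_inv g *v v)) ((+) v ` lattice_of g) = P (matrix_inv g *v v)" for v
        by (rule torus_fun_translate[OF G(3)])
          (simp add: matrix_vector_right_distrib trig_poly_periodic[OF P(1) g_int])
      have *: "\<bar>integral\<^sup>L \<nu> f - I' P\<bar> \<le> e"
        unfolding I'_def
      proof (rule N.expectation_diff_le[OF f_\<nu> int'[OF P(1)]])
        show "AE z in \<nu>. \<bar>f z - torus_fun (lattice_of g) (\<lambda>v. P (matrix_inv g *v v)) z\<bar> \<le> e"
          using AE_\<nu>
        proof eventually_elim
          case (elim z)
          then obtain v where z: "z = (+) v ` lattice_of g" by blast
          show ?case
            using P(2)[of "matrix_inv g *v v"] nz unfolding z P_tor' by (simp add: matrix_inv_mult_vec)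
        qed
      qed
      have "\<forall>\<^sub>F l in sequentially. \<bar>I P l - I' P\<bar> < e"
        using tendstoD[OF I_lim[OF P(1)] \<open>e > 0\<close>] by (simp add: dist_real_def)
      moreover have "\<forall>\<^sub>F l in sequentially. \<bar>(\<integral>z. f ((*v) (H l) ` z) \<partial>\<mu>) - I P l\<bar> \<le> 2 * e"
        using eventually_uniformly_close_on_fibres[OF f G \<open>e > 0\<close>]
      proof eventually_elim
        case (elim l)
        show ?case
          unfolding I_def
        proof (rule M.expectation_diff_le[OF f_H int[OF P(1)]])
          show "AE z in \<mu>. \<bar>f ((*v) (H l) ` z) - torus_fun (lattice_of g\<^sub>0) (\<lambda>v. P (A l *v v)) z\<bar> \<le> 2 * e"
            using AE_\<mu>
          proof eventually_elim
            case z: (elim z)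
            then obtain v where z: "z = (+) v ` lattice_of g\<^sub>0" by blast
            show ?case
              using elim[rule_format, of "A l *v v"] P(2)[of "A l *v v"] unfolding z P_tor H_grid by linarith
          qed
        qed
      qed
      ultimately have "\<forall>\<^sub>F l in sequentially. \<bar>(\<integral>z. f ((*v) (H l) ` z) \<partial>\<mu>) - integral\<^sup>L \<nu> f\<bar> < r"
        by eventually_elim (use * in \<open>unfold e_def, linarith\<close>)
      then show "\<forall>\<^sub>F l in sequentially. dist (integral\<^sup>L (distr \<mu> ?Y ((`) ((*v) (H l)))) f) (integral\<^sup>L \<nu> f) < r"
        by (simp add: dist_real_def integral_distr[OF H_meas f_meas])
    qed
  qed
qed

text \<open>Dropping finitely many terms keeps the sequence unbounded, and nonnegativity makes
  unboundedness mean large positive values.\<close>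

lemma unbounded_nonneg_large_index:
  fixes s :: "nat \<Rightarrow> real"
  assumes "\<And>k. 0 \<le> s k" "\<not> bounded (range s)"
  shows "\<exists>k\<ge>N. K \<le> s k"
proof (rule ccontr)
  assume "\<not> (\<exists>k\<ge>N. K \<le> s k)"
  then have "range s \<subseteq> s ` {..<N} \<union> {0..K}"
    using assms(1) by (auto simp: not_le)
  moreover have "bounded (s ` {..<N} \<union> {0..K})" by (simp add: finite_imp_bounded)
  ultimately show False using assms(2) bounded_subset by blast
qed

text \<open>For each \<open>j\<close> pick an index late enough for a basis within
  \<open>1 / (j + 1)\<close> of \<open>g\<close> and with time at least \<open>j\<close>. This
  upgrades an unbounded sequence of times to a divergent one and lifts the lattices to convergent
  matrices.\<close>

lemma flow_limit_sequence:
  fixes g :: "real^('m::finite + 'n::finite)^('m + 'n)"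
  assumes g: "det g = 1" and lim: "lattice_of g \<in> flow_limits x"
  obtains t :: "nat \<Rightarrow> real" and G where "\<And>l. 0 \<le> t l" "filterlim t at_top sequentially"
    "\<And>l. det (G l) = 1" "G \<longlonglongrightarrow> g" "\<And>l. (*v) (diag_flow (t l)) ` x = lattice_of (G l)"
proof -
  from lim obtain s :: "nat \<Rightarrow> real" where s: "\<And>k. 0 \<le> s k" "\<not> bounded (range s)"
    "limitin lattice_space (\<lambda>k. (*v) (diag_flow (s k)) ` x) (lattice_of g) sequentially"
    by (auto simp: flow_limits_def)
  have "\<exists>k h. real j \<le> s k \<and> det h = 1 \<and> dist h g < inverse (real (Suc j)) \<and> (*v) (diag_flow (s k)) ` x = lattice_of h" for j
  proof -
    obtain N where N: "\<And>k. k \<ge> N \<Longrightarrow> \<exists>h. det h = 1 \<and> dist h g < inverse (real (Suc j)) \<and> (*v) (diag_flow (s k)) ` x = lattice_of h"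
      using eventually_lattice_lift[OF g s(3), of "inverse (real (Suc j))"]
      by (auto simp: eventually_sequentially)
    obtain k where "k \<ge> N" "real j \<le> s k" using unbounded_nonneg_large_index[of s N "real j"] s by blast
    then show ?thesis using N by blast
  qed
  then obtain \<kappa> G where *: "\<And>j. real j \<le> s (\<kappa> j)" "\<And>j. det (G j) = 1"
    "\<And>j. dist (G j) g < inverse (real (Suc j))" "\<And>j. (*v) (diag_flow (s (\<kappa> j))) ` x = lattice_of (G j)"
    by metis
  show thesis
  proof
    show "filterlim (\<lambda>j. s (\<kappa> j)) at_top sequentially"
      by (rule filterlim_at_top_mono[OF filterlim_real_sequentially]) (simp add: *)
    have "(\<lambda>j. dist (G j) g) \<longlonglongrightarrow> 0"
      by (rule tendsto_sandwich[OF _ _ tendsto_const LIMSEQ_inverse_real_of_nat])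
        (use *(3) in \<open>auto intro!: always_eventually less_imp_le simp del: of_nat_Suc\<close>)
    then show "G \<longlonglongrightarrow> g" by (simp add: tendsto_dist_iff[symmetric])
  qed (use s * in auto)
qed

section \<open>From the flow orbit to the limit measure\<close>

lemma dim_image_det_nonzero:
  fixes A :: "real^'d^'d"
  assumes "det A \<noteq> 0"
  shows "dim ((*v) A ` S) = dim S"
  using assms
  by (intro dim_image_eq inj_on_subset[OF inj_matrix_vector_mult]) (simp_all add: invertible_det_nz)

theorem theorem6p4:
  fixes x\<^sub>0 x\<^sub>1 :: "(real^('m::finite + 'n::finite)) set"
    and \<mu> :: "(real^('m + 'n)) set measure" and k :: nat
  assumes "coprime CARD('m) CARD('n)"
    and "x\<^sub>0 \<in> topspace lattice_space" and "x\<^sub>1 \<in> topspace lattice_space"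
    and "x\<^sub>1 \<in> flow_limits x\<^sub>0"
    and "algebraic_measure x\<^sub>0 k \<mu>" and "1 \<le> k" and "k < CARD('m) + CARD('n)"
  shows "\<exists>(t :: nat \<Rightarrow> real) \<nu> k'.
    (\<forall>l. 0 \<le> t l) \<and> filterlim t at_top sequentially \<and>
    limitin (weak_star_topology grid_space)
      (\<lambda>l. distr \<mu> (borel_sigma grid_space) ((`) ((*v) (diag_flow (t l))))) \<nu> sequentially \<and>
    algebraic_measure x\<^sub>1 k' \<nu> \<and> k + 1 \<le> k'"
proof -
  obtain g\<^sub>0 where g\<^sub>0: "det g\<^sub>0 = 1" "x\<^sub>0 = lattice_of g\<^sub>0"
    using assms(2) by (auto simp: topspace_lattice_space)
  obtain g where g: "det g = 1" "x\<^sub>1 = lattice_of g"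
    using assms(3) by (auto simp: topspace_lattice_space)
  obtain s H where s: "\<And>l. 0 \<le> s l" "filterlim s at_top sequentially"
    and H: "\<And>l. det (H l) = 1" "H \<longlonglongrightarrow> g" "\<And>l. (*v) (diag_flow (s l)) ` x\<^sub>0 = lattice_of (H l)"
    using flow_limit_sequence[OF g(1)] assms(4) g(2) by metis
  from assms(5) obtain U y where \<mu>: "prob_space \<mu>" "sets \<mu> = sets (borel_sigma grid_space)"
    and U: "rational_subspace x\<^sub>0 U" "dim U = k" and y: "y \<in> lattice_torus x\<^sub>0"
    and supp: "emeasure \<mu> ((\<lambda>u. (+) u ` y) ` U) = 1"
    and inv: "\<And>u. u \<in> U \<Longrightarrow> distr \<mu> (borel_sigma grid_space) ((`) ((+) u)) = \<mu>"
    unfolding algebraic_measure_def by blast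
  obtain v\<^sub>0 where v\<^sub>0: "y = (+) v\<^sub>0 ` lattice_of g\<^sub>0"
    using y assms(2) by (auto simp: g\<^sub>0(2) lattice_torus_eq)
  from U(1) obtain B' where B': "subspace U" "B' \<subseteq> U \<inter> x\<^sub>0" "independent B'" "span B' = U"
    unfolding rational_subspace_def by blast
  \<comment> \<open>In the coordinates given by the matrix of \<open>x\<^sub>0\<close>, an
    \<open>x\<^sub>0\<close>-rational subspace becomes one spanned by integer vectors.\<close>
  define B\<^sub>0 where "B\<^sub>0 = (*v) (matrix_inv g\<^sub>0) ` B'"
  have inj_inv: "inj ((*v) (matrix_inv g\<^sub>0))"
    using g\<^sub>0(1) by (intro inj_matrix_vector_mult) (simp add: invertible_det_nz det_matrix_inv)
  have B\<^sub>0: "B\<^sub>0 \<subseteq> integer_vectors" "independent B\<^sub>0" "span B\<^sub>0 = (*v) (matrix_inv g\<^sub>0) ` U" "card B\<^sub>0 = k"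
  proof -
    show "B\<^sub>0 \<subseteq> integer_vectors"
      using B'(2) g\<^sub>0 by (auto simp: B\<^sub>0_def lattice_of_def matrix_inv_mult_vec)
    show "independent B\<^sub>0"
      unfolding B\<^sub>0_def using B'(3) inj_inv
      by (intro linear_independent_injective_image) (auto intro: inj_on_subset)
    show "span B\<^sub>0 = (*v) (matrix_inv g\<^sub>0) ` U"
      unfolding B\<^sub>0_def B'(4)[symmetric] by (rule linear_span_image) simp
    show "card B\<^sub>0 = k"
      using dim_eq_card_independent[OF B'(3)] dim_span[of B'] B'(4) U(2) inj_inv
      by (simp add: B\<^sub>0_def card_image inj_on_subset)
  qed
  \<comment> \<open>\<open>A l\<close> maps \<open>x\<^sub>0\<close> onto the integer lattice: it is
    the flow followed by the transport to the standard torus. The subspaces \<open>UA l\<close> are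
    the integral directions of the transported measures.\<close>
  define A where "A l = matrix_inv (H l) ** diag_flow (s l)" for l
  have detA: "det (A l) = 1" for l by (simp add: A_def det_mul det_matrix_inv H det_diag_flow)
  define UA where "UA l = (*v) (A l) ` U" for l
  obtain B r where B: "B \<subseteq> integer_vectors" "independent B" "strict_mono (r :: nat \<Rightarrow> nat)"
    and perp': "\<forall>l. \<forall>w \<in> span B. \<forall>u \<in> UA (r l). w \<bullet> u = 0"
    and not_perp: "\<forall>\<xi> \<in> integer_vectors - span B.
      \<forall>\<^sub>F l in sequentially. \<exists>u \<in> UA (r l). \<xi> \<bullet> u \<noteq> 0"
    by (rule exists_maximal_limit_annihilator[of UA])
  have perp: "w \<bullet> (A (r l) *v u) = 0" if "w \<in> span B" "u \<in> U" for l w u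
    using perp' that by (auto simp: UA_def)
  \<comment> \<open>Base points matter only modulo integer vectors, so they can be kept in the unit
    cube. A further subsequence makes them converge to \<open>w\<close>, the base point of the limit
    measure.\<close>
  have "\<exists>p. p \<in> integer_vectors \<and> A (r l) *v v\<^sub>0 - p \<in> cbox 0 1" for l
    using exists_cube_representative[of "A (r l) *v v\<^sub>0"] by metis
  then obtain p where p: "\<And>l. p l \<in> integer_vectors" "\<And>l. A (r l) *v v\<^sub>0 - p l \<in> cbox 0 1" by metis
  have "seq_compact (cbox 0 (1 :: real^('m + 'n)))" by (rule compact_imp_seq_compact[OF compact_cbox])
  then obtain w q where q: "strict_mono (q :: nat \<Rightarrow> nat)"
    and w: "((\<lambda>l. A (r l) *v v\<^sub>0 - p l) \<circ> q) \<longlonglongrightarrow> w"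
    by (rule seq_compactE[of _ "\<lambda>l. A (r l) *v v\<^sub>0 - p l"]) (use p(2) in auto)
  have w: "(\<lambda>l. A (r (q l)) *v v\<^sub>0 - p (q l)) \<longlonglongrightarrow> w"
    using w by (simp add: o_def)
  define \<rho> where "\<rho> l = r (q l)" for l
  have \<rho>: "filterlim \<rho> at_top sequentially"
    using strict_mono_o[OF B(3) q] by (intro filterlim_subseq) (simp add: \<rho>_def[abs_def] o_def)
  \<comment> \<open>The limit measure is invariant along the complement of the persistent
    frequencies, which again has an integral basis.\<close>
  obtain C where C: "C \<subseteq> integer_vectors" "independent C" "span C = (span B)\<^sup>\<bottom>"
    "card C + card B = CARD('m + 'n)"
    by (rule integer_basis_orthogonal_comp[OF B(1,2)])
  have A_C: "A (\<rho> l) *v u \<in> span C" if "u \<in> U" for l u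
    unfolding C(3) using perp that by (auto simp: orthogonal_comp_def orthogonal_def \<rho>_def)
  have limG: "(\<lambda>l. H (\<rho> l)) \<longlonglongrightarrow> g" by (rule filterlim_compose[OF H(2) \<rho>])
  have limt: "filterlim (\<lambda>l. s (\<rho> l)) at_top sequentially" by (rule filterlim_compose[OF s(2) \<rho>])
  \<comment> \<open>The moving subspaces all lie in \<open>span C\<close>, so
    \<open>card C \<ge> k\<close> is automatic. Equality would mean that they always fill the same
    rational subspace, which the nonzero weights forbid.\<close>
  have "k + 1 \<le> card C"
  proof (rule ccontr)
    assume small: "\<not> k + 1 \<le> card C"
    \<comment> \<open>The change between two bases of the same lattice, the flowed one and the one
      converging to \<open>g\<close>; hence it is integral with determinant 1.\<close>
    define \<gamma> where "\<gamma> l = A (\<rho> l) ** g\<^sub>0" for l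
    have \<gamma>_sub: "(*v) (\<gamma> l) ` span B\<^sub>0 \<subseteq> span C" for l
      using A_C g\<^sub>0(1) by (auto simp: \<gamma>_def B\<^sub>0(3) matrix_vector_mul_assoc[symmetric] matrix_inv_mult_vec)
    have det\<gamma>: "det (\<gamma> l) = 1" for l by (simp add: \<gamma>_def det_mul detA g\<^sub>0)
    have "k = dim ((*v) (\<gamma> 0) ` span B\<^sub>0)"
      using det\<gamma>[of 0] B\<^sub>0(4) dim_eq_card_independent[OF B\<^sub>0(2)] by (simp add: dim_image_det_nonzero)
    also have "\<dots> \<le> card C"
      using dim_subset[OF \<gamma>_sub] dim_eq_card_independent[OF C(2)] by simp
    finally have card_eq: "card C = card B\<^sub>0" using small B\<^sub>0(4) by simp
    have int\<gamma>: "int_matrix (\<gamma> l)" for l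
    proof -
      have "lattice_of (diag_flow (s (\<rho> l)) ** g\<^sub>0) = lattice_of (H (\<rho> l))"
        unfolding lattice_of_mult g\<^sub>0(2)[symmetric] by (rule H(3))
      then have "int_matrix (matrix_inv (H (\<rho> l)) ** (diag_flow (s (\<rho> l)) ** g\<^sub>0))"
        by (intro int_matrix_if_lattice_of_subset) (simp_all add: H)
      then show ?thesis by (simp add: \<gamma>_def A_def matrix_mul_assoc)
    qed
    have flow_eq: "diag_flow (s (\<rho> l)) ** g\<^sub>0 = H (\<rho> l) ** \<gamma> l" for l
      by (simp add: \<gamma>_def A_def matrix_mul_assoc[symmetric] matrix_inv_mult_mat H)
    show False
      by (rule flow_not_returning_to_rational_subspace[where \<gamma> = \<gamma>,
            OF assms(1) B\<^sub>0(1,2) _ _ C(1,2) card_eq limG g(1) int\<gamma> det\<gamma> flow_eq limt \<gamma>_sub])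
        (use assms(6,7) B\<^sub>0(4) in auto)
  qed
  obtain \<nu> where \<nu>: "prob_space \<nu>" "sets \<nu> = sets (borel_sigma grid_space)"
    "emeasure \<nu> ((\<lambda>u. (+) u ` ((+) (g *v w) ` lattice_of g)) ` ((*v) g ` span C)) = 1"
    "\<forall>u \<in> (*v) g ` span C. distr \<nu> (borel_sigma grid_space) ((`) ((+) u)) = \<nu>"
    by (rule exists_coset_measure[OF g(1) C(1) independent_imp_finite[OF C(2)]])
  have sub: "subspace ((*v) g ` span C)"
    by (rule linear_subspace_image) simp_all
  have "limitin (weak_star_topology grid_space)
      (\<lambda>l. distr \<mu> (borel_sigma grid_space) ((`) ((*v) (diag_flow (s (\<rho> l)))))) \<nu> sequentially"
  proof (rule weak_star_limit_coset_measures[OF g\<^sub>0(1) limG H(1) g(1) det_diag_flow H(3)[unfolded g\<^sub>0(2)]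
        \<mu> B'(1) supp[unfolded v\<^sub>0] inv \<nu>(1,2) sub \<nu>(3) bspec[OF \<nu>(4)]])
    fix \<xi> :: "real^('m + 'n)" and c :: real assume \<xi>: "\<xi> \<in> integer_vectors"
    \<comment> \<open>Taking the complement twice identifies the integral frequencies annihilating
      the limit subspace with those in \<open>span B\<close>.\<close>
    have "span B = (span C)\<^sup>\<bottom>" by (simp add: C(3) orthogonal_comp_self)
    then have cond: "(\<forall>u\<in>(*v) g ` span C. \<xi> \<bullet> (matrix_inv g *v u) = 0) \<longleftrightarrow> \<xi> \<in> span B"
      using g(1) by (auto simp: matrix_inv_mult_vec orthogonal_comp_def orthogonal_def inner_commute)
    have "(\<lambda>l. if \<forall>u\<in>U. \<xi> \<bullet> (A (\<rho> l) *v u) = 0 then cos (2 * pi * (\<xi> \<bullet> (A (\<rho> l) *v v\<^sub>0)) + c) else 0)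
        \<longlonglongrightarrow> (if \<xi> \<in> span B then cos (2 * pi * (\<xi> \<bullet> w) + c) else 0)"
    proof (cases "\<xi> \<in> span B")
      case True
      \<comment> \<open>The frequency is integral, so subtracting the integer vector
        \<open>p (q l)\<close> from the base point changes the phase by a multiple of
        \<open>2 * pi\<close>; the character values then converge with the base points.\<close>
      have "cos (2 * pi * (\<xi> \<bullet> (A (\<rho> l) *v v\<^sub>0)) + c)
          = cos (2 * pi * (\<xi> \<bullet> (A (r (q l)) *v v\<^sub>0 - p (q l))) + c)" for l
        using cos_add_Ints[OF inner_integer_vectors[OF \<xi> p(1)],
            of "2 * pi * (\<xi> \<bullet> (A (r (q l)) *v v\<^sub>0 - p (q l))) + c" "q l"]
        by (simp add: \<rho>_def inner_diff_right algebra_simps)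
      moreover have "(\<lambda>l. cos (2 * pi * (\<xi> \<bullet> (A (r (q l)) *v v\<^sub>0 - p (q l))) + c))
          \<longlonglongrightarrow> cos (2 * pi * (\<xi> \<bullet> w) + c)"
        by (intro tendsto_intros w)
      moreover have "\<forall>u\<in>U. \<xi> \<bullet> (A (\<rho> l) *v u) = 0" for l
        using perp[OF True] by (auto simp: \<rho>_def)
      ultimately show ?thesis using True by simp
    next
      case False
      \<comment> \<open>By maximality of \<open>B\<close> this frequency annihilates only finitely
        many of the subspaces, so its coefficients are eventually 0, as in the limit.\<close>
      have "\<forall>\<^sub>F l in sequentially. \<exists>u \<in> UA (r (q l)). \<xi> \<bullet> u \<noteq> 0"
        using eventually_compose_filterlim[OF not_perp[rule_format, of \<xi>] filterlim_subseq[OF q]] \<xi> False by blast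
      then have "\<forall>\<^sub>F l in sequentially. (if \<forall>u\<in>U. \<xi> \<bullet> (A (\<rho> l) *v u) = 0
          then cos (2 * pi * (\<xi> \<bullet> (A (\<rho> l) *v v\<^sub>0)) + c) else 0) = 0"
        by eventually_elim (auto simp: \<rho>_def UA_def)
      then show ?thesis using False by (simp add: tendsto_eventually)
    qed
    then show "(\<lambda>l. if \<forall>u\<in>U. \<xi> \<bullet> ((matrix_inv (H (\<rho> l)) ** diag_flow (s (\<rho> l))) *v u) = 0
          then cos (2 * pi * (\<xi> \<bullet> ((matrix_inv (H (\<rho> l)) ** diag_flow (s (\<rho> l))) *v v\<^sub>0)) + c) else 0)
        \<longlonglongrightarrow> (if \<forall>u\<in>(*v) g ` span C. \<xi> \<bullet> (matrix_inv g *v u) = 0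
          then cos (2 * pi * (\<xi> \<bullet> w) + c) else 0)"
      unfolding cond A_def .
  qed
  moreover have "algebraic_measure x\<^sub>1 (card C) \<nu>"
    unfolding algebraic_measure_def
  proof (intro conjI exI bexI)
    show "prob_space \<nu>" "sets \<nu> = sets (borel_sigma grid_space)" by (rule \<nu>)+
    have inj_g: "inj ((*v) g)"
      using g(1) by (intro inj_matrix_vector_mult) (simp add: invertible_det_nz)
    have "independent ((*v) g ` C)"
      using C(2) inj_g by (intro linear_independent_injective_image) (auto intro: inj_on_subset)
    moreover have "span ((*v) g ` C) = (*v) g ` span C" by (rule linear_span_image) simp
    moreover have "(*v) g ` C \<subseteq> (*v) g ` span C \<inter> x\<^sub>1"
      using C(1) by (auto simp: g(2) intro: span_base lattice_ofI)
    ultimately show "rational_subspace x\<^sub>1 ((*v) g ` span C)"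
      using sub unfolding rational_subspace_def by blast
    show "dim ((*v) g ` span C) = card C"
      using g(1) C(2) by (simp add: dim_image_det_nonzero dim_eq_card_independent)
    show "(+) (g *v w) ` lattice_of g \<in> lattice_torus x\<^sub>1"
      using assms(3) by (simp add: lattice_torus_eq g(2)[symmetric])
  qed (use \<nu>(3,4) in auto)
  ultimately show ?thesis
    using s(1) limt \<open>k + 1 \<le> card C\<close> by (intro exI[of _ "\<lambda>l. s (\<rho> l)"] exI[of _ \<nu>] exI[of _ "card C"]) simp
qed

end
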